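(* Let $\mathcal{Q}$ be a Descartes configuration in $\mathbb{R}^2$ whose four curvatures are integers with greatest common divisor $1$. Then there exists a Descartes configuration $\mathcal{Q}'$ in $\mathbb{R}^2$ with the same four curvatures such that, in the Apollonian packing generated by $\mathcal{Q}'$: (1) every disk $A$ of the packing has integral symbol, i.e. $\dot x_A,\dot y_A,A,A^c\in\mathbb{Z}$; (2) for every pair of tangent disks $A,B$ of the packing, the tangency spinor $\mathrm{spin}(A,B)=m+ni$ is a Gaussian integer ($m,n\in\mathbb{Z}$); (3) for every disk $A$ of the packing, the space-time coordinates $z=(A-A^c)/2$ and $t=(A+A^c)/2$ are integers (equivalently $A\equiv A^c \pmod 2$).
   Context: A (generalized) disk in $\mathbb{R}^2$ is one of: (i) a closed round disk of radius $r>0$ with center $(x,y)$, with curvature $A=1/r$; (ii) the closure of the complement of an open round disk of radius $r>0$ with center $(x,y)$, with curvature $A=-1/r$; (iii) a closed half-plane $\{p\in\mathbb{R}^2: p\cdot n\ge h\}$ with $n$ a unit vector and $h\in\mathbb{R}$, with curvature $A=0$. A disk and its curvature are denoted by the same letter. The symbol of a disk $A$ is the quadruple $(\dot x_A,\dot y_A,A,A^c)$, where in cases (i),(ii) the reduced coordinates are $\dot x_A=Ax$, $\dot y_A=Ay$ and the co-curvature is $A^c=(\dot x_A^2+\dot y_A^2-1)/A$ (this equals the curvature of the image of the disk under inversion in the unit circle), and in case (iii) $(\dot x_A,\dot y_A)=n$ and $A^c=2h$. Two disks are tangent if their interiors are disjoint and their boundaries meet in exactly one point, or they are two half-planes with disjoint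 interiors and parallel boundary lines. For tangent disks $A,B$ the tangency spinor $\mathrm{spin}(A,B)\in\mathbb{C}$ is defined up to sign by $\mathrm{spin}(A,B)^2=(A\dot x_B-B\dot x_A)+i\,(A\dot y_B-B\dot y_A)$ (for two round disks with centers $c_A,c_B\in\mathbb{C}$ and signed radii $r_A=1/A$, $r_B=1/B$ this is $\pm\sqrt{(c_B-c_A)/(r_Ar_B)}$). A Descartes configuration is a set of four pairwise tangent generalized disks with pairwise disjoint interiors. Given three of its disks, there are exactly two disks tangent to all three with interiors disjoint from them; the one not in the configuration is the Descartes conjugate of the fourth. The Apollonian packing generated by a Descartes configuration is the collection of all disks appearing in Descartes configurations obtained from it by finitely many replacements of a disk by its Descartes conjugate. *)

theory Defs
  imports "HOL-Analysis.Analysis" "HOL-Library.Multiset"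
begin

datatype gdisk = Disk complex real | CoDisk complex real | HalfPl complex real

fun wf_disk :: "gdisk \<Rightarrow> bool" where
  "wf_disk (Disk c r) = (r > 0)"
| "wf_disk (CoDisk c r) = (r > 0)"
| "wf_disk (HalfPl n h) = (norm n = 1)"

fun region :: "gdisk \<Rightarrow> complex set" where
  "region (Disk c r) = cball c r"
| "region (CoDisk c r) = closure (- ball c r)"
| "region (HalfPl n h) = {p. p \<bullet> n \<ge> h}"

fun curv :: "gdisk \<Rightarrow> real" where
  "curv (Disk c r) = 1 / r"
| "curv (CoDisk c r) = - 1 / r"
| "curv (HalfPl n h) = 0"

fun xdot :: "gdisk \<Rightarrow> real" where
  "xdot (Disk c r) = Re c / r"
| "xdot (CoDisk c r) = - Re c / r"
| "xdot (HalfPl n h) = Re n"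

fun ydot :: "gdisk \<Rightarrow> real" where
  "ydot (Disk c r) = Im c / r"
| "ydot (CoDisk c r) = - Im c / r"
| "ydot (HalfPl n h) = Im n"

fun cocurv :: "gdisk \<Rightarrow> real" where
  "cocurv (HalfPl n h) = 2 * h"
| "cocurv A = ((xdot A)\<^sup>2 + (ydot A)\<^sup>2 - 1) / curv A"

definition tangent :: "gdisk \<Rightarrow> gdisk \<Rightarrow> bool" where
  "tangent A B \<longleftrightarrow> wf_disk A \<and> wf_disk B \<and>
     interior (region A) \<inter> interior (region B) = {} \<and>
     ((\<exists>!p. p \<in> frontier (region A) \<inter> frontier (region B)) \<or>
      (\<exists>nA hA nB hB. A = HalfPl nA hA \<and> B = HalfPl nB hB \<and>
          (nB = nA \<or> nB = - nA)))"

definition spin_sq :: "gdisk \<Rightarrow> gdisk \<Rightarrow> complex" where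
  "spin_sq A B = Complex (curv A * xdot B - curv B * xdot A) (curv A * ydot B - curv B * ydot A)"

definition descartes_config :: "gdisk set \<Rightarrow> bool" where
  "descartes_config Q \<longleftrightarrow> card Q = 4 \<and> (\<forall>A\<in>Q. wf_disk A) \<and>
     (\<forall>A\<in>Q. \<forall>B\<in>Q. A \<noteq> B \<longrightarrow> tangent A B \<and>
        interior (region A) \<inter> interior (region B) = {})"

definition descartes_step :: "gdisk set \<Rightarrow> gdisk set \<Rightarrow> bool" where
  "descartes_step Q Q' \<longleftrightarrow> (\<exists>A\<in>Q. \<exists>A'. wf_disk A' \<and> A' \<noteq> A \<and>
      (\<forall>B\<in>Q - {A}. tangent A' B \<and> interior (region A') \<inter> interior (region B) = {}) \<and>
      Q' = insert A' (Q - {A}))"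

definition apollonian_packing :: "gdisk set \<Rightarrow> gdisk set" where
  "apollonian_packing Q = \<Union>{Q'. descartes_step\<^sup>*\<^sup>* Q Q'}"

end

theory Submission
  imports Defs
begin

text \<open>Symbols of disks are the vectors of square \<open>1\<close> in Lorentz 4-space, tangency means product \<open>-1\<close>,
  and replacing a disk by its conjugate is the linear move \<open>v4 := 2 (v1 + v2 + v3) - v4\<close>.

  Existence: besides conjugation, consider inversion in the boundary of a disk,
  \<open>v4 := - v4, vj := vj + 2 v4\<close>. Under these moves every primitive integral solution of
  Descartes' equation descends to the curvatures \<open>(0, 0, 1, 1)\<close>, and both moves preserve integrality of
  symbols, the parity condition, and a normal form in which the six squared spinors are squares of
  explicit Gaussian linear forms in two Gaussian integers. Undoing the descent from a suitably placed
  strip therefore yields a good configuration with the given curvatures.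

  The whole packing: conjugation preserves the same data. Two tangent disks \<open>A\<close>, \<open>B\<close> of the packing
  lie in a common configuration: start a word without backtracking at a configuration containing \<open>A\<close>;
  once \<open>A\<close> has been replaced, every new disk has product at most \<open>-7\<close> with \<open>A\<close>.\<close>

section \<open>Lorentz products and spinors\<close>

type_synonym lvec = "complex \<times> real \<times> real"

text \<open>The polarisation of x^2 + y^2 - a c. In the coordinates z = (a - c)/2 and t = (a + c)/2
  this is x^2 + y^2 + z^2 - t^2, the Lorentz form in the space-time coordinates of a symbol.\<close>

definition lip :: "lvec \<Rightarrow> lvec \<Rightarrow> real" where
  "lip v w = fst v \<bullet> fst w - (fst (snd v) * snd (snd w) + snd (snd v) * fst (snd w)) / 2"

text \<open>The squared tangency spinor, extended to an alternating bilinear expression on all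
  vectors, so that it can be expanded along linear moves.\<close>

definition spn :: "lvec \<Rightarrow> lvec \<Rightarrow> complex" where
  "spn v w = of_real (fst (snd v)) * fst w - of_real (fst (snd w)) * fst v"

definition symb :: "gdisk \<Rightarrow> lvec" where
  "symb A = (Complex (xdot A) (ydot A), curv A, cocurv A)"

lemma spin_sq_symb: "spin_sq A B = spn (symb A) (symb B)"
  by (simp add: spin_sq_def spn_def symb_def complex_eq_iff)

lemma lip_commute: "lip v w = lip w v"
  by (simp add: lip_def inner_commute algebra_simps)

lemma lip_linear [simp]:
  "lip (u + v) w = lip u w + lip v w" "lip w (u + v) = lip w u + lip w v"
  "lip (u - v) w = lip u w - lip v w" "lip w (u - v) = lip w u - lip w v"
  "lip (- v) w = - lip v w" "lip w (- v) = - lip w v"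
  "lip (c *\<^sub>R v) w = c * lip v w" "lip w (c *\<^sub>R v) = c * lip w v"
  "lip 0 w = 0" "lip w 0 = 0"
  by (simp_all add: lip_def inner_add_left inner_add_right inner_diff_left inner_diff_right field_simps)

lemma spn_linear [simp]:
  "spn (u + v) w = spn u w + spn v w" "spn w (u + v) = spn w u + spn w v"
  "spn (u - v) w = spn u w - spn v w" "spn w (u - v) = spn w u - spn w v"
  "spn (- v) w = - spn v w" "spn w (- v) = - spn w v"
  "spn (c *\<^sub>R v) w = of_real c * spn v w" "spn w (c *\<^sub>R v) = of_real c * spn w v"
  by (simp_all add: spn_def algebra_simps scaleR_conv_of_real)

lemma spn_swap: "spn w v = - spn v w"
  by (simp add: spn_def)

lemma spn_self [simp]: "spn v v = 0"
  by (simp add: spn_def)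

lemma lip_sum: "lip v (\<Sum>x\<in>S. f x) = (\<Sum>x\<in>S. lip v (f x))"
  by (induction S rule: infinite_finite_induct) simp_all

section \<open>Disks and their symbols\<close>

lemma symb_simps:
  "r > 0 \<Longrightarrow> symb (Disk c r) = (c / of_real r, 1 / r, ((norm c)\<^sup>2 - r\<^sup>2) / r)"
  "r > 0 \<Longrightarrow> symb (CoDisk c r) = (- c / of_real r, - 1 / r, (r\<^sup>2 - (norm c)\<^sup>2) / r)"
  "symb (HalfPl n h) = (n, 0, 2 * h)"
proof -
  have "((Re c / r)\<^sup>2 + (Im c / r)\<^sup>2 - 1) * r = ((norm c)\<^sup>2 - r\<^sup>2) / r" if "r > 0"
    using that by (simp add: cmod_power2 power_divide) (simp add: power2_eq_square field_simps)
  then show "r > 0 \<Longrightarrow> symb (Disk c r) = (c / of_real r, 1 / r, ((norm c)\<^sup>2 - r\<^sup>2) / r)"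
    "r > 0 \<Longrightarrow> symb (CoDisk c r) = (- c / of_real r, - 1 / r, (r\<^sup>2 - (norm c)\<^sup>2) / r)"
    by (auto simp: symb_def complex_eq_iff minus_divide_left[symmetric] algebra_simps diff_divide_distrib)
qed (simp add: symb_def complex_eq_iff)

lemma lip_symb_self: "wf_disk A \<Longrightarrow> lip (symb A) (symb A) = 1"
  by (cases A) (simp_all add: symb_simps lip_def dot_square_norm norm_divide power2_eq_square field_simps)

text \<open>The sign of the curvature determines the constructor. Radius and centre are then read
  off, and for a half-plane the co-curvature gives \<open>h\<close>.\<close>

lemma inj_symb:
  assumes "wf_disk A" "wf_disk B" "symb A = symb B"
  shows "A = B"
  using assms
  by (cases A; cases B) (auto simp: symb_def complex_eq_iff field_simps)

text \<open>For nonzero curvature, \<open>lip v v = 1\<close> determines the co-curvature from the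
  other entries. For curvature 0 it says that \<open>z\<close> is a unit normal.\<close>

lemma ex_symb:
  assumes "lip v v = 1"
  shows "\<exists>A. wf_disk A \<and> symb A = v"
proof -
  obtain z a c where v: "v = (z, a, c)" by (cases v) auto
  have z: "(Re z)\<^sup>2 + (Im z)\<^sup>2 - a * c = 1"
    using assms by (simp add: v lip_def inner_complex_def power2_eq_square algebra_simps)
  consider "a > 0" | "a < 0" | "a = 0" by linarith
  then show ?thesis
  proof cases
    case 1
    then have "wf_disk (Disk (z / of_real a) (1 / a)) \<and> symb (Disk (z / of_real a) (1 / a)) = v"
      using z by (auto simp: v symb_def complex_eq_iff Re_divide_of_real Im_divide_of_real field_simps)
    then show ?thesis by blast
  next
    case 2
    then have "wf_disk (CoDisk (z / of_real a) (- 1 / a)) \<and> symb (CoDisk (z / of_real a) (- 1 / a)) = v"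
      using z by (auto simp: v symb_def complex_eq_iff Re_divide_of_real Im_divide_of_real field_simps)
    then show ?thesis by blast
  next
    case 3
    then have "wf_disk (HalfPl z (c / 2)) \<and> symb (HalfPl z (c / 2)) = v"
      using z by (auto simp: v symb_def complex_eq_iff cmod_def)
    then show ?thesis by blast
  qed
qed

lemma interior_region:
  "wf_disk (Disk c r) \<Longrightarrow> interior (region (Disk c r)) = ball c r"
  "wf_disk (CoDisk c r) \<Longrightarrow> interior (region (CoDisk c r)) = - cball c r"
  "wf_disk (HalfPl n h) \<Longrightarrow> interior (region (HalfPl n h)) = {p. p \<bullet> n > h}"
proof -
  show "wf_disk (CoDisk c r) \<Longrightarrow> interior (region (CoDisk c r)) = - cball c r"
    by (simp add: closure_complement interior_complement)
  show "interior (region (HalfPl n h)) = {p. p \<bullet> n > h}" if "wf_disk (HalfPl n h)"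
  proof -
    have "n \<noteq> 0" using that by auto
    then show ?thesis by (simp add: inner_commute[of _ n] interior_halfspace_ge)
  qed
qed simp

lemma frontier_region:
  "wf_disk (Disk c r) \<Longrightarrow> frontier (region (Disk c r)) = sphere c r"
  "wf_disk (CoDisk c r) \<Longrightarrow> frontier (region (CoDisk c r)) = sphere c r"
  "wf_disk (HalfPl n h) \<Longrightarrow> frontier (region (HalfPl n h)) = {p. p \<bullet> n = h}"
proof -
  show "frontier (region (CoDisk c r)) = sphere c r" if "wf_disk (CoDisk c r)"
    using that by (auto simp: frontier_def closure_complement interior_complement)
  show "frontier (region (HalfPl n h)) = {p. p \<bullet> n = h}" if "wf_disk (HalfPl n h)"
  proof -
    have "n \<noteq> 0" using that by auto
    then show ?thesis by (simp add: inner_commute[of _ n] frontier_halfspace_ge)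
  qed
qed simp

section \<open>Lorentz products of concrete disks compared with tangency\<close>

lemma lip_disk_disk:
  assumes "r > 0" "s > 0"
  shows "lip (symb (Disk c r)) (symb (Disk d s)) = (r\<^sup>2 + s\<^sup>2 - (dist c d)\<^sup>2) / (2 * r * s)"
proof -
  have "(dist c d)\<^sup>2 = (norm c)\<^sup>2 + (norm d)\<^sup>2 - 2 * (c \<bullet> d)"
    by (simp add: dist_norm power2_norm_eq_inner inner_diff_left inner_diff_right inner_commute[of d c])
  moreover have "(c / of_real r) \<bullet> (d / of_real s) = (c \<bullet> d) / (r * s)"
    by (simp add: inner_complex_def add_divide_distrib)
  ultimately show ?thesis
    using assms by (simp add: symb_simps lip_def power2_eq_square) (simp add: field_simps)
qed

text \<open>The value -1 means that the distance of the centres is the absolute value of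
  \<open>r - s\<close>. Which circle lies inside the other is invisible to the product.\<close>

lemma lip_disk_codisk:
  assumes "r > 0" "s > 0"
  shows "lip (symb (Disk c r)) (symb (CoDisk d s)) = ((dist c d)\<^sup>2 - r\<^sup>2 - s\<^sup>2) / (2 * r * s)"
proof -
  have "(dist c d)\<^sup>2 = (norm c)\<^sup>2 + (norm d)\<^sup>2 - 2 * (c \<bullet> d)"
    by (simp add: dist_norm power2_norm_eq_inner inner_diff_left inner_diff_right inner_commute[of d c])
  moreover have "(c / of_real r) \<bullet> (d / of_real s) = (c \<bullet> d) / (r * s)"
    by (simp add: inner_complex_def add_divide_distrib)
  ultimately show ?thesis
    using assms by (simp add: symb_simps lip_def power2_eq_square) (simp add: field_simps)
qed

lemma lip_disk_halfpl:
  assumes "r > 0"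
  shows "lip (symb (Disk c r)) (symb (HalfPl n h)) = (c \<bullet> n - h) / r"
  using assms by (simp add: symb_def lip_def inner_complex_def field_simps)

lemma lip_halfpl_halfpl: "lip (symb (HalfPl n h)) (symb (HalfPl m k)) = n \<bullet> m"
  by (simp add: symb_def lip_def inner_complex_def)

text \<open>Replacing both symbols by their negatives keeps the product, so -1 alone cannot tell two
  disks from their two complements. The sign of the curvature sum makes this choice; pairs of
  half-planes are left open.\<close>

definition signs_ok :: "gdisk \<Rightarrow> gdisk \<Rightarrow> bool" where
  "signs_ok A B \<longleftrightarrow> curv A + curv B > 0 \<or> curv A = 0 \<and> curv B = 0"

lemma tangent_commute: "tangent A B \<Longrightarrow> tangent B A"
  unfolding tangent_def by (metis (no_types, lifting) Int_commute minus_minus)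

lemma norm_unit_antipodal:
  fixes n m :: complex
  assumes "norm n = 1" "norm m = 1" "n \<bullet> m \<le> -1"
  shows "m = - n"
proof -
  have "n \<bullet> n = 1" "m \<bullet> m = 1"
    using assms by (simp_all add: dot_square_norm)
  then have "(n + m) \<bullet> (n + m) = 2 + 2 * (n \<bullet> m)"
    by (simp add: inner_add_left inner_add_right inner_commute[of m n])
  then have "(n + m) \<bullet> (n + m) \<le> 0" using assms by simp
  then have "n + m = 0" by (metis inner_ge_zero inner_eq_zero_iff order_antisym)
  then show ?thesis by (simp add: eq_neg_iff_add_eq_0 add.commute)
qed

lemma tangent_disk_disk:
  assumes "tangent (Disk c r) (Disk d s)"
  shows "dist c d = r + s"
proof -
  have rs: "r > 0" "s > 0" and dj: "ball c r \<inter> ball d s = {}"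
    using assms by (auto simp: tangent_def)
  obtain p where p: "p \<in> sphere c r" "p \<in> sphere d s"
    using assms by (auto simp: tangent_def)
  have "dist c d \<le> r + s" using p dist_triangle[of c d p] by (simp add: dist_commute)
  moreover have "dist c d \<ge> r + s"
  proof (rule ccontr)
    assume *: "\<not> ?thesis"
    \<comment> \<open>\<open>q\<close> divides the segment of centres in the ratio
      \<open>r : s\<close>; if the centres are too close, it lies in both open disks.\<close>
    define q where "q = c + (r / (r + s)) *\<^sub>R (d - c)"
    have "dist c q = r / (r + s) * dist c d"
      using rs by (simp add: q_def dist_norm norm_minus_commute)
    moreover have "r / (r + s) * dist c d < r"
      using * rs mult_strict_left_mono[of "dist c d" "r + s" "r"] by (simp add: field_simps)
    moreover have "d - q = (s / (r + s)) *\<^sub>R (d - c)"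
    proof -
      have *: "s / (r + s) = 1 - r / (r + s)" using rs by (simp add: field_simps)
      show ?thesis unfolding * by (simp add: q_def algebra_simps)
    qed
    then have "dist d q = s / (r + s) * dist c d"
      using rs by (simp add: dist_norm norm_minus_commute)
    moreover have "s / (r + s) * dist c d < s"
      using * rs mult_strict_left_mono[of "dist c d" "r + s" "s"] by (simp add: field_simps)
    ultimately have "q \<in> ball c r \<inter> ball d s" by simp
    then show False using dj by blast
  qed
  ultimately show ?thesis by simp
qed

lemma tangent_disk_codisk:
  assumes "tangent (Disk c r) (CoDisk d s)"
  shows "dist c d = s - r" "r < s"
proof -
  have wf: "wf_disk (Disk c r)" "wf_disk (CoDisk d s)" using assms by (auto simp: tangent_def)
  have rs: "r > 0" "s > 0" and dj: "ball c r \<inter> - cball d s = {}"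
    using assms interior_region(1)[OF wf(1)] interior_region(2)[OF wf(2)] by (auto simp: tangent_def)
  have ex: "\<exists>!p. p \<in> sphere c r \<inter> sphere d s"
    using assms frontier_region(1)[OF wf(1)] frontier_region(2)[OF wf(2)] by (auto simp: tangent_def)
  then obtain p where p: "p \<in> sphere c r" "p \<in> sphere d s" by auto
  have "ball c r \<subseteq> cball d s" using dj by blast
  then have "dist c d + r \<le> s" using rs by (simp add: ball_subset_cball_iff)
  moreover have "s \<le> dist c d + r" using p dist_triangle[of d p c] by (simp add: dist_commute)
  ultimately show d: "dist c d = s - r" by simp
  \<comment> \<open>Internal tangency only gives \<open>r \<le> s\<close>. Equal radii would make
    the circles coincide, against the uniqueness of the common boundary point.\<close>
  show "r < s"
  proof (rule ccontr)
    assume "\<not> ?thesis"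
    then have "c = d" "r = s" using d zero_le_dist[of c d] by auto
    moreover have "c + of_real r \<in> sphere c r" "c - of_real r \<in> sphere c r"
      using rs by (auto simp: dist_norm)
    ultimately have "c + of_real r = c - of_real r" using ex by blast
    then show False using rs by (simp add: complex_eq_iff)
  qed
qed

lemma tangent_disk_halfpl:
  assumes "tangent (Disk c r) (HalfPl n h)"
  shows "c \<bullet> n = h - r"
proof -
  have wf: "wf_disk (Disk c r)" "wf_disk (HalfPl n h)" using assms by (auto simp: tangent_def)
  have r: "r > 0" and n: "norm n = 1" "n \<bullet> n = 1" using wf by (auto simp: dot_square_norm)
  have dj: "ball c r \<inter> {p. p \<bullet> n > h} = {}"
    using assms interior_region(1)[OF wf(1)] interior_region(3)[OF wf(2)] by (auto simp: tangent_def)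
  obtain p where p: "p \<in> sphere c r" "p \<bullet> n = h"
    using assms frontier_region(1)[OF wf(1)] frontier_region(3)[OF wf(2)] by (auto simp: tangent_def)
  have "(p - c) \<bullet> n \<le> norm (p - c) * norm n" by (rule norm_cauchy_schwarz)
  then have 1: "h - c \<bullet> n \<le> r" using p n by (simp add: inner_diff_left dist_norm norm_minus_commute)
  moreover have "c \<bullet> n + r \<le> h"
  proof (rule ccontr)
    assume *: "\<not> ?thesis"
    \<comment> \<open>The midpoint between \<open>h - c \<bullet> n\<close> and \<open>r\<close>,
      cut off at 0 so that it is also the norm of the displacement along \<open>n\<close>.\<close>
    define t where "t = max 0 ((h - c \<bullet> n + r) / 2)"
    have t: "0 \<le> t" "t < r" "c \<bullet> n + t > h" using * 1 r by (auto simp: t_def max_def field_simps)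
    have "c + t *\<^sub>R n \<in> ball c r" using t n by (simp add: dist_norm)
    moreover have "(c + t *\<^sub>R n) \<bullet> n > h" using t n by (simp add: inner_add_left)
    ultimately show False using dj by blast
  qed
  ultimately show ?thesis by simp
qed

text \<open>Two disjoint exteriors would cover the plane by two bounded balls.\<close>

lemma not_tangent_codisk_codisk: "\<not> tangent (CoDisk c r) (CoDisk d s)"
proof
  assume t: "tangent (CoDisk c r) (CoDisk d s)"
  then have wf: "wf_disk (CoDisk c r)" "wf_disk (CoDisk d s)" by (auto simp: tangent_def)
  have "- cball c r \<inter> - cball d s = {}"
    using t interior_region(2)[OF wf(1)] interior_region(2)[OF wf(2)] by (auto simp: tangent_def)
  then have "cball c r \<union> cball d s = UNIV" by blast
  then have "bounded (UNIV :: complex set)" by (metis bounded_Un bounded_cball)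
  then show False by simp
qed

lemma not_tangent_codisk_halfpl: "\<not> tangent (CoDisk c r) (HalfPl n h)"
proof
  assume t: "tangent (CoDisk c r) (HalfPl n h)"
  then have wf: "wf_disk (CoDisk c r)" "wf_disk (HalfPl n h)" by (auto simp: tangent_def)
  have n: "norm n = 1" "n \<bullet> n = 1" using wf by (auto simp: dot_square_norm)
  have dj: "- cball c r \<inter> {p. p \<bullet> n > h} = {}"
    using t interior_region(2)[OF wf(1)] interior_region(3)[OF wf(2)] by (auto simp: tangent_def)
  \<comment> \<open>Far enough along the normal, a point is both outside the ball and inside the
    half-plane.\<close>
  define x where "x = \<bar>r\<bar> + \<bar>h - c \<bullet> n\<bar> + 1"
  have "c + x *\<^sub>R n \<in> - cball c r" using n by (simp add: dist_norm x_def)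
  moreover have "(c + x *\<^sub>R n) \<bullet> n > h" using n by (simp add: inner_add_left x_def)
  ultimately show False using dj by blast
qed

lemma tangent_halfpl_halfpl:
  assumes "tangent (HalfPl n h) (HalfPl m k)"
  shows "m = - n"
proof (rule ccontr)
  assume ne: "m \<noteq> - n"
  have wf: "wf_disk (HalfPl n h)" "wf_disk (HalfPl m k)" using assms by (auto simp: tangent_def)
  have n: "norm n = 1" "n \<bullet> n = 1" "norm m = 1" "m \<bullet> m = 1" using wf by (auto simp: dot_square_norm)
  have dj: "{p. p \<bullet> n > h} \<inter> {p. p \<bullet> m > k} = {}"
    using assms interior_region(3)[OF wf(1)] interior_region(3)[OF wf(2)] by (auto simp: tangent_def)
  have "n \<bullet> m > -1" using norm_unit_antipodal[of n m] n ne by force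
  \<comment> \<open>\<open>e\<close> is the inner product of \<open>n + m\<close> with
    \<open>n\<close> and also with \<open>m\<close>, so a large multiple of \<open>n + m\<close>
    enters both half-planes.\<close>
  then obtain e where e: "e = 1 + n \<bullet> m" "e > 0" by simp
  define t where "t = (\<bar>h\<bar> + \<bar>k\<bar> + 1) / e"
  have "t * e > h" "t * e > k" using e by (auto simp: t_def)
  then have "(t *\<^sub>R (n + m)) \<bullet> n > h" "(t *\<^sub>R (n + m)) \<bullet> m > k"
    using e n by (simp_all add: inner_add_left inner_commute[of m n] add.commute)
  then show False using dj by blast
qed

lemma tangent_imp_lip:
  assumes "tangent A B"
  shows "lip (symb A) (symb B) = -1 \<and> signs_ok A B"
proof -
  have dd: ?thesis if "A = Disk c r" "B = Disk d s" for c r d s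
  proof -
    have "r > 0" "s > 0" using assms that by (auto simp: tangent_def)
    moreover have "dist c d = r + s" using tangent_disk_disk assms that by blast
    ultimately show ?thesis unfolding that
      by (simp add: lip_disk_disk signs_ok_def power2_eq_square field_simps)
  qed
  \<comment> \<open>Stated for fresh \<open>A\<close> and \<open>B\<close>, so that it serves both
    orders of the pair; \<open>comm\<close> turns the result around. The same holds for
    \<open>dh\<close>.\<close>
  have dc: "lip (symb A) (symb B) = -1 \<and> signs_ok A B"
    if "tangent A B" "A = Disk c r" "B = CoDisk d s" for A B c r d s
  proof -
    have "r > 0" "s > 0" using that by (auto simp: tangent_def)
    moreover have d: "dist c d = s - r" and "r < s" using tangent_disk_codisk that by blast+
    ultimately show ?thesis unfolding that
      by (simp add: lip_disk_codisk signs_ok_def d power2_eq_square del: dist_eq_0_iff)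
        (simp add: field_simps)
  qed
  have dh: "lip (symb A) (symb B) = -1 \<and> signs_ok A B"
    if "tangent A B" "A = Disk c r" "B = HalfPl n h" for A B c r n h
  proof -
    have "r > 0" using that by (auto simp: tangent_def)
    moreover have "c \<bullet> n = h - r" using tangent_disk_halfpl that by blast
    ultimately show ?thesis unfolding that
      by (simp add: lip_disk_halfpl signs_ok_def)
  qed
  have hh: ?thesis if "A = HalfPl n h" "B = HalfPl m k" for n h m k
  proof -
    have "norm n = 1" using assms that by (auto simp: tangent_def)
    moreover have "m = - n" using tangent_halfpl_halfpl assms that by blast
    ultimately show ?thesis unfolding that
      by (simp add: lip_halfpl_halfpl signs_ok_def dot_square_norm)
  qed
  have comm: "lip (symb B) (symb A) = -1 \<and> signs_ok B A \<Longrightarrow> ?thesis"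
    by (auto simp: lip_commute signs_ok_def add.commute)
  show ?thesis
  proof (cases A)
    case (Disk c r)
    show ?thesis
    proof (cases B)
      case (CoDisk d s) then show ?thesis using dc[OF assms Disk] by blast
    next
      case (HalfPl n h) then show ?thesis using dh[OF assms Disk] by blast
    qed (use dd Disk in blast)
  next
    case (CoDisk d s)
    show ?thesis
    proof (cases B)
      case (Disk c r)
      then show ?thesis using dc[OF tangent_commute[OF assms] Disk CoDisk] comm by blast
    qed (use not_tangent_codisk_codisk not_tangent_codisk_halfpl assms CoDisk in auto)
  next
    case (HalfPl n h)
    show ?thesis
    proof (cases B)
      case (Disk c r)
      then show ?thesis using dh[OF tangent_commute[OF assms] Disk HalfPl] comm by blast
    qed (use hh not_tangent_codisk_halfpl tangent_commute[OF assms] HalfPl in auto)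
  qed
qed

lemma unique_point_between:
  fixes c d :: complex
  assumes "dist c d = r + s" "r > 0" "s > 0"
  shows "\<exists>!p. dist c p = r \<and> dist p d = s"
proof (rule ex1I)
  define q where "q = c + (r / (r + s)) *\<^sub>R (d - c)"
  have "q - d = (- s / (r + s)) *\<^sub>R (d - c)"
  proof -
    have *: "- s / (r + s) = r / (r + s) - 1" using assms by (simp add: field_simps)
    show ?thesis unfolding * by (simp add: q_def algebra_simps)
  qed
  then show "dist c q = r \<and> dist q d = s"
    using assms by (simp add: dist_norm norm_minus_commute) (simp add: q_def norm_minus_commute)
  show "p = q" if p: "dist c p = r \<and> dist p d = s" for p
  proof -
    \<comment> \<open>Equality in the triangle inequality puts \<open>p\<close> on the segment of
      centres.\<close>
    have "r *\<^sub>R (p - d) = s *\<^sub>R (c - p)"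
      using dist_triangle_eq[of c d p] p assms by (simp add: dist_norm)
    then have "(r + s) *\<^sub>R p = s *\<^sub>R c + r *\<^sub>R d" by (simp add: algebra_simps)
    also have "\<dots> = (r + s) *\<^sub>R c + r *\<^sub>R (d - c)" by (simp add: algebra_simps)
    also have "\<dots> = (r + s) *\<^sub>R q" using assms by (simp add: q_def scaleR_add_right)
    finally show ?thesis using assms by simp
  qed
qed

text \<open>The converse of \<open>tangent_imp_lip\<close>. The product of two half-planes does not
  involve their offsets, so \<open>co\<close> has to supply their disjointness.\<close>

lemma lip_imp_tangent:
  assumes wf: "wf_disk A" "wf_disk B" and l: "lip (symb A) (symb B) = -1" and sg: "signs_ok A B"
    and co: "curv A = 0 \<Longrightarrow> curv B = 0 \<Longrightarrow> cocurv A + cocurv B \<ge> 0"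
  shows "tangent A B"
proof -
  have dd: ?thesis if AB: "A = Disk c r" "B = Disk d s" for c r d s
  proof -
    have rs: "r > 0" "s > 0" using wf AB by auto
    have "(dist c d)\<^sup>2 = (r + s)\<^sup>2"
      using l rs by (simp add: AB lip_disk_disk power2_eq_square field_simps)
    then have d: "dist c d = r + s" using rs by (simp add: power2_eq_iff_nonneg)
    have "ball c r \<inter> ball d s = {}" by (rule disjoint_ballI) (simp add: d)
    moreover have "\<exists>!p. p \<in> sphere c r \<inter> sphere d s"
      using unique_point_between[OF d rs] by (simp add: dist_commute)
    ultimately show ?thesis using wf unfolding tangent_def AB by simp
  qed
  have dc: "tangent A B"
    if "A = Disk c r" "B = CoDisk d s" "wf_disk A" "wf_disk B" "lip (symb A) (symb B) = -1" "signs_ok A B"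
    for A B c r d s
  proof -
    have rs: "r > 0" "s > 0" using that by auto
    then have less: "r < s" using that by (simp add: signs_ok_def field_simps)
    have "(dist c d)\<^sup>2 = (s - r)\<^sup>2"
      using that(5) rs by (simp add: that(1,2) lip_disk_codisk power2_eq_square field_simps)
    then have d: "dist c d = s - r" using rs less by (simp add: power2_eq_iff_nonneg)
    have "ball c r \<subseteq> cball d s" using d rs by (simp add: ball_subset_cball_iff)
    then have "ball c r \<inter> - cball d s = {}" by blast
    moreover have "\<exists>!p. p \<in> sphere c r \<inter> sphere d s"
    proof (rule ex1I)
      \<comment> \<open>The point of internal contact: on the ray from \<open>d\<close> through
        \<open>c\<close>, at distance \<open>r\<close> beyond \<open>c\<close>.\<close>
      define q where "q = c + (r / (s - r)) *\<^sub>R (c - d)"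
      have "q - d = (s / (s - r)) *\<^sub>R (c - d)"
      proof -
        have "s / (s - r) = r / (s - r) + 1" using less by (simp add: field_simps)
        then show ?thesis by (simp add: q_def algebra_simps)
      qed
      then have "dist q d = s" using d rs less by (simp add: dist_norm)
      moreover have "dist c q = r" using d rs less by (simp add: q_def dist_norm)
      ultimately show "q \<in> sphere c r \<inter> sphere d s" by (simp add: dist_commute)
      show "p = q" if p: "p \<in> sphere c r \<inter> sphere d s" for p
      proof -
        have "dist d p = dist d c + dist c p" using p d by (simp add: dist_commute)
        then have "dist d c *\<^sub>R (c - p) = dist c p *\<^sub>R (d - c)"
          using dist_triangle_eq[of d p c] by (simp add: dist_norm)
        then have "(s - r) *\<^sub>R (c - p) = r *\<^sub>R (d - c)"
          using p d by (simp add: dist_commute[of d c])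
        then have "(s - r) *\<^sub>R p = (s - r) *\<^sub>R c + r *\<^sub>R (c - d)" by (simp add: algebra_simps)
        also have "\<dots> = (s - r) *\<^sub>R q" using less by (simp add: q_def scaleR_add_right)
        finally show ?thesis using less by simp
      qed
    qed
    ultimately show ?thesis
      using interior_region(2)[of d s] frontier_region(2)[of d s] that(3,4)
      unfolding tangent_def that(1,2) by simp
  qed
  have dh: "tangent A B"
    if "A = Disk c r" "B = HalfPl n h" "wf_disk A" "wf_disk B" "lip (symb A) (symb B) = -1"
    for A B c r n h
  proof -
    have r: "r > 0" and n: "norm n = 1" "n \<bullet> n = 1" using that by (auto simp: dot_square_norm)
    have c: "c \<bullet> n = h - r" using that(5) r by (simp add: that(1,2) lip_disk_halfpl field_simps)
    have "ball c r \<inter> {p. p \<bullet> n > h} = {}"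
    proof -
      have "p \<bullet> n < h" if "dist c p < r" for p
        using norm_cauchy_schwarz[of "p - c" n] that c n
        by (simp add: inner_diff_left dist_norm norm_minus_commute)
      then show ?thesis by force
    qed
    moreover have "\<exists>!p. p \<in> sphere c r \<inter> {p. p \<bullet> n = h}"
    proof (rule ex1I)
      show "c + r *\<^sub>R n \<in> sphere c r \<inter> {p. p \<bullet> n = h}"
        using r n c by (simp add: dist_norm inner_add_left)
      show "p = c + r *\<^sub>R n" if p: "p \<in> sphere c r \<inter> {p. p \<bullet> n = h}" for p
      proof -
        have "(p - c) \<bullet> (p - c) = r\<^sup>2" "(p - c) \<bullet> n = r"
          using p c by (auto simp: dot_square_norm dist_norm norm_minus_commute inner_diff_left)
        \<comment> \<open>The square expands to r^2 - 2 r^2 + r^2, so \<open>p\<close> is the foot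
          of the perpendicular from \<open>c\<close> to the line.\<close>
        then have "(p - c - r *\<^sub>R n) \<bullet> (p - c - r *\<^sub>R n) = 0"
          using n by (simp only: inner_diff_left[of "p - c"] inner_diff_right[of _ "p - c"]
              inner_commute[of n "p - c"] inner_scaleR_left inner_scaleR_right)
            (simp add: power2_eq_square)
        then have "p - c - r *\<^sub>R n = 0" by (simp only: inner_eq_zero_iff)
        then show ?thesis by (simp add: algebra_simps)
      qed
    qed
    ultimately show ?thesis
      using interior_region(3)[of n h] frontier_region(3)[of n h] that(3,4)
      unfolding tangent_def that(1,2) by simp
  qed
  have hh: ?thesis if AB: "A = HalfPl n h" "B = HalfPl m k" for n h m k
  proof -
    have m: "m = - n" using norm_unit_antipodal[of n m] wf l by (simp add: AB lip_halfpl_halfpl)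
    have "h + k \<ge> 0" using co by (simp add: AB)
    then have "{p. p \<bullet> n > h} \<inter> {p. p \<bullet> m > k} = {}" by (auto simp: m)
    then show ?thesis
      using interior_region(3)[of n h] interior_region(3)[of m k] wf m
      unfolding tangent_def AB by auto
  qed
  have comm: "lip (symb B) (symb A) = -1" "signs_ok B A"
    using l sg by (auto simp: lip_commute signs_ok_def add.commute)
  have cc: False if "A = CoDisk c r" "B = CoDisk d s" for c r d s
    using wf sg that by (auto simp: signs_ok_def field_simps)
  have ch: False if "A = CoDisk c r \<and> B = HalfPl n h \<or> B = CoDisk c r \<and> A = HalfPl n h" for c r n h
    using wf sg that by (auto simp: signs_ok_def field_simps)
  show ?thesis
  proof (cases A)
    case (Disk c r)
    show ?thesis
    proof (cases B)
      case (CoDisk d s) then show ?thesis using dc[OF Disk CoDisk] wf l sg by blast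
    next
      case (HalfPl n h) then show ?thesis using dh[OF Disk HalfPl] wf l by blast
    qed (use dd Disk in blast)
  next
    case (CoDisk d s)
    show ?thesis
    proof (cases B)
      case (Disk c r) then show ?thesis using dc[OF Disk CoDisk] wf comm tangent_commute by blast
    qed (use cc ch CoDisk in blast)+
  next
    case (HalfPl n h)
    show ?thesis
    proof (cases B)
      case (Disk c r) then show ?thesis using dh[OF Disk HalfPl] wf comm tangent_commute by blast
    qed (use hh ch HalfPl in blast)+
  qed
qed

section \<open>Quadruples of pairwise tangent symbols\<close>

definition gram :: "lvec \<Rightarrow> lvec \<Rightarrow> lvec \<Rightarrow> lvec \<Rightarrow> bool" where
  "gram v1 v2 v3 v4 \<longleftrightarrow>
     lip v1 v1 = 1 \<and> lip v2 v2 = 1 \<and> lip v3 v3 = 1 \<and> lip v4 v4 = 1 \<and>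
     lip v1 v2 = -1 \<and> lip v1 v3 = -1 \<and> lip v1 v4 = -1 \<and>
     lip v2 v3 = -1 \<and> lip v2 v4 = -1 \<and> lip v3 v4 = -1"

lemma gram_all:
  assumes "gram v1 v2 v3 v4"
  shows "lip v1 v1 = 1" "lip v2 v2 = 1" "lip v3 v3 = 1" "lip v4 v4 = 1"
    "lip v1 v2 = -1" "lip v1 v3 = -1" "lip v1 v4 = -1"
    "lip v2 v3 = -1" "lip v2 v4 = -1" "lip v3 v4 = -1"
    "lip v2 v1 = -1" "lip v3 v1 = -1" "lip v4 v1 = -1"
    "lip v3 v2 = -1" "lip v4 v2 = -1" "lip v4 v3 = -1"
  using assms lip_commute unfolding gram_def by (metis (no_types))+

text \<open>The Gram matrix is G = 2 I - J with J the all-ones matrix, and J^2 = 4 J gives G^2 = 4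
  I. So G, applied to the products of \<open>e\<close> with the four vectors, yields four times the
  coordinates of \<open>e\<close>.\<close>

lemma gram_expand:
  assumes "gram v1 v2 v3 v4"
  defines "S \<equiv> \<lambda>e. lip e v1 + lip e v2 + lip e v3 + lip e v4"
  shows "4 *\<^sub>R e = (2 * lip e v1 - S e) *\<^sub>R v1 + (2 * lip e v2 - S e) *\<^sub>R v2
      + (2 * lip e v3 - S e) *\<^sub>R v3 + (2 * lip e v4 - S e) *\<^sub>R v4"
proof -
  note g = gram_all[OF assms(1)]
  \<comment> \<open>The four real entries of \<open>x\<close> serve as coefficients, so
    \<open>f\<close> is an endomorphism of a four-dimensional space and injectivity gives
    surjectivity: the \<open>vi\<close> form a basis.\<close>
  define f :: "lvec \<Rightarrow> lvec" where
    "f x = Re (fst x) *\<^sub>R v1 + Im (fst x) *\<^sub>R v2 + fst (snd x) *\<^sub>R v3 + snd (snd x) *\<^sub>R v4" for x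
  have lin: "linear f"
    by (rule linearI) (auto simp: f_def algebra_simps)
  have "inj f"
    unfolding linear_injective_0[OF lin]
  proof (intro allI impI)
    fix x assume "f x = 0"
    then have "lip (f x) v = 0" for v by simp
    from this[of v1] this[of v2] this[of v3] this[of v4]
    have "Re (fst x) = 0" "Im (fst x) = 0" "fst (snd x) = 0" "snd (snd x) = 0"
      by (simp_all add: f_def g)
    then show "x = 0" by (simp add: prod_eq_iff complex_eq_iff)
  qed
  then have "surj f" by (rule linear_injective_imp_surjective[OF lin]) simp
  then obtain x where x: "e = f x" by blast
  have l: "lip e v1 = Re (fst x) - Im (fst x) - fst (snd x) - snd (snd x)"
    "lip e v2 = Im (fst x) - Re (fst x) - fst (snd x) - snd (snd x)"
    "lip e v3 = fst (snd x) - Re (fst x) - Im (fst x) - snd (snd x)"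
    "lip e v4 = snd (snd x) - Re (fst x) - Im (fst x) - fst (snd x)"
    by (simp_all add: x f_def g)
  then have "2 * lip e v1 - S e = 4 * Re (fst x)" "2 * lip e v2 - S e = 4 * Im (fst x)"
    "2 * lip e v3 - S e = 4 * fst (snd x)" "2 * lip e v4 - S e = 4 * snd (snd x)"
    by (simp_all add: S_def)
  then show ?thesis by (simp add: x f_def scaleR_add_right)
qed

text \<open>The vector \<open>(0, 0, 1)\<close> is null and its product with a symbol is minus half
  the curvature. Expanding it in the basis turns \<open>lip e e = 0\<close> into Descartes'
  equation.\<close>

lemma descartes_circle:
  assumes "gram (z1, a1, c1) (z2, a2, c2) (z3, a3, c3) (z4, a4, c4)"
  shows "2 * (a1\<^sup>2 + a2\<^sup>2 + a3\<^sup>2 + a4\<^sup>2) = (a1 + a2 + a3 + a4)\<^sup>2"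
proof -
  define e :: lvec where "e = (0, 0, 1)"
  have e: "lip e (z, a, c) = - a / 2" "lip e e = 0" for z a c by (simp_all add: e_def lip_def)
  have "lip e (4 *\<^sub>R e) = 0" by (simp add: e)
  then show ?thesis
    unfolding gram_expand[OF assms, of e] lip_linear e by (simp add: power2_eq_square field_simps)
qed

text \<open>Only the product \<open>x\<close> of \<open>w\<close> with \<open>v4\<close> is unknown,
  and \<open>lip w w = 1\<close> gives (x - 1)(x + 7) = 0. The root 1 is \<open>v4\<close> itself,
  the root -7 its conjugate.\<close>

lemma conjugate_unique:
  assumes g: "gram v1 v2 v3 v4"
    and w: "lip w v1 = -1" "lip w v2 = -1" "lip w v3 = -1" "lip w w = 1" and ne: "w \<noteq> v4"
  shows "w = 2 *\<^sub>R (v1 + v2 + v3) - v4"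
proof -
  define x where "x = lip w v4"
  have e: "4 *\<^sub>R w = (1 - x) *\<^sub>R (v1 + v2 + v3) + (x + 3) *\<^sub>R v4"
    using gram_expand[OF g, of w] w by (simp add: x_def[symmetric] algebra_simps)
  have "4 * lip w w = lip w (4 *\<^sub>R w)" by simp
  also have "\<dots> = -3 * (1 - x) + (x + 3) * x"
    unfolding e by (simp add: w x_def)
  finally have "(x - 1) * (x + 7) = 0" using w by (simp add: algebra_simps)
  then consider "x = 1" | "x = -7" by auto
  then show ?thesis
  proof cases
    case 1 then show ?thesis using e ne by simp
  next
    case 2
    then have "4 *\<^sub>R w = 4 *\<^sub>R (2 *\<^sub>R (v1 + v2 + v3) - v4)" using e by (simp add: algebra_simps)
    then show ?thesis by (simp only: scaleR_cancel_left) simp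
  qed
qed

section \<open>Gaussian integers and integral symbols\<close>

definition gaussian :: "complex set" where
  "gaussian = {z. Re z \<in> \<int> \<and> Im z \<in> \<int>}"

lemma gaussian_closed [simp, intro]:
  "z \<in> gaussian \<Longrightarrow> w \<in> gaussian \<Longrightarrow> z + w \<in> gaussian"
  "z \<in> gaussian \<Longrightarrow> w \<in> gaussian \<Longrightarrow> z - w \<in> gaussian"
  "z \<in> gaussian \<Longrightarrow> w \<in> gaussian \<Longrightarrow> z * w \<in> gaussian"
  "z \<in> gaussian \<Longrightarrow> - z \<in> gaussian"
  "0 \<in> gaussian" "1 \<in> gaussian" "numeral k \<in> gaussian" "\<i> \<in> gaussian"
  by (auto simp: gaussian_def)

lemma gaussian_iff: "z \<in> gaussian \<longleftrightarrow> (\<exists>m n :: int. z = of_int m + \<i> * of_int n)"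
  by (fastforce simp: gaussian_def complex_eq_iff elim!: Ints_cases)

text \<open>Integrality of \<open>a\<close> and z = (a - c)/2 already contains that of the other two
  quantities, since c = a - 2 z and (a + c)/2 = a - z.\<close>

definition integral_symbol :: "lvec \<Rightarrow> bool" where
  "integral_symbol v \<longleftrightarrow> fst v \<in> gaussian \<and> fst (snd v) \<in> \<int> \<and>
     (fst (snd v) - snd (snd v)) / 2 \<in> \<int>"

lemma integral_symbol_closed [simp, intro]:
  assumes "integral_symbol v" "integral_symbol w"
  shows "integral_symbol (v + w)" "integral_symbol (v - w)" "integral_symbol (- v)"
    "integral_symbol (2 *\<^sub>R v)"
proof -
  have add: "integral_symbol (v + w)" if "integral_symbol v" "integral_symbol w" for v w
  proof -
    have "(fst (snd (v + w)) - snd (snd (v + w))) / 2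
        = (fst (snd v) - snd (snd v)) / 2 + (fst (snd w) - snd (snd w)) / 2"
      by (simp add: field_simps)
    then show ?thesis using that unfolding integral_symbol_def by (metis Ints_add fst_add gaussian_closed(1) snd_add)
  qed
  have neg: "integral_symbol (- v)" if "integral_symbol v" for v
  proof -
    have "(fst (snd (- v)) - snd (snd (- v))) / 2 = - ((fst (snd v) - snd (snd v)) / 2)"
      by (simp add: field_simps)
    then show ?thesis using that unfolding integral_symbol_def
      by (metis Ints_minus fst_uminus gaussian_closed(4) snd_uminus)
  qed
  show "integral_symbol (v + w)" "integral_symbol (- v)" using add neg assms by blast+
  show "integral_symbol (v - w)" using add[of v "- w"] neg assms by simp
  show "integral_symbol (2 *\<^sub>R v)" using add[of v v] assms by (simp add: scaleR_2)
qed

lemma integral_symbolD: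
  assumes "integral_symbol (z, a, c)"
  shows "Re z \<in> \<int>" "Im z \<in> \<int>" "a \<in> \<int>" "c \<in> \<int>" "(a - c) / 2 \<in> \<int>" "(a + c) / 2 \<in> \<int>"
proof -
  show *: "Re z \<in> \<int>" "Im z \<in> \<int>" "a \<in> \<int>" "(a - c) / 2 \<in> \<int>"
    using assms by (auto simp: integral_symbol_def gaussian_def)
  have "a - 2 * ((a - c) / 2) \<in> \<int>" using * by (intro Ints_diff Ints_mult) auto
  then show "c \<in> \<int>" by (simp add: field_simps)
  have "a - (a - c) / 2 \<in> \<int>" using * by (intro Ints_diff) auto
  then show "(a + c) / 2 \<in> \<int>" by (simp add: field_simps)
qed

section \<open>The normal form of the six spinors and its invariance under moves\<close>

text \<open>Three tangency spinors around a triple sum to zero once their signs are chosen suitably, so two of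
  them, \<open>a\<close> and \<open>b\<close>, determine the third. All spinors towards the fourth disk are then Gaussian linear
  combinations of \<open>a\<close> and \<open>b\<close>; the choice of \<open>I\<close> tells the fourth disk from its conjugate.\<close>
definition spinorial :: "lvec \<Rightarrow> lvec \<Rightarrow> lvec \<Rightarrow> lvec \<Rightarrow> bool" where
  "spinorial v1 v2 v3 v4 \<longleftrightarrow> (\<exists>a\<in>gaussian. \<exists>b\<in>gaussian. \<exists>I\<in>{\<i>, - \<i>}.
     spn v1 v2 = a\<^sup>2 \<and> spn v2 v3 = b\<^sup>2 \<and> spn v3 v1 = (a + b)\<^sup>2 \<and>
     spn v1 v4 = - (b + (1 + I) * a)\<^sup>2 \<and> spn v2 v4 = (b + I * a)\<^sup>2 \<and>
     spn v3 v4 = ((1 - I) * b + a)\<^sup>2)"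

text \<open>Adds the reversed pairs and the membership of \<open>- I\<close>, because every move
  below takes \<open>- I\<close> as its new witness.\<close>

lemma spinorialE:
  assumes "spinorial v1 v2 v3 v4"
  obtains a b I where "a \<in> gaussian" "b \<in> gaussian" "I \<in> gaussian" "- I \<in> {\<i>, - \<i>}" "I * I = -1"
    "spn v1 v2 = a\<^sup>2" "spn v2 v3 = b\<^sup>2" "spn v3 v1 = (a + b)\<^sup>2"
    "spn v1 v4 = - (b + (1 + I) * a)\<^sup>2" "spn v2 v4 = (b + I * a)\<^sup>2"
    "spn v3 v4 = ((1 - I) * b + a)\<^sup>2"
    "spn v2 v1 = - a\<^sup>2" "spn v3 v2 = - b\<^sup>2" "spn v1 v3 = - (a + b)\<^sup>2"
    "spn v4 v1 = (b + (1 + I) * a)\<^sup>2" "spn v4 v2 = - (b + I * a)\<^sup>2"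
    "spn v4 v3 = - ((1 - I) * b + a)\<^sup>2"
proof -
  obtain a b I where *: "a \<in> gaussian" "b \<in> gaussian" "I \<in> {\<i>, - \<i>}"
    "spn v1 v2 = a\<^sup>2" "spn v2 v3 = b\<^sup>2" "spn v3 v1 = (a + b)\<^sup>2"
    "spn v1 v4 = - (b + (1 + I) * a)\<^sup>2" "spn v2 v4 = (b + I * a)\<^sup>2"
    "spn v3 v4 = ((1 - I) * b + a)\<^sup>2"
    using assms unfolding spinorial_def by blast
  moreover have "I \<in> gaussian" "- I \<in> {\<i>, - \<i>}" "I * I = -1" using * by auto
  moreover have "spn v2 v1 = - a\<^sup>2" "spn v3 v2 = - b\<^sup>2" "spn v1 v3 = - (a + b)\<^sup>2"
    "spn v4 v1 = (b + (1 + I) * a)\<^sup>2" "spn v4 v2 = - (b + I * a)\<^sup>2"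
    "spn v4 v3 = - ((1 - I) * b + a)\<^sup>2"
    using * spn_swap[of v2 v1] spn_swap[of v3 v2] spn_swap[of v1 v3]
      spn_swap[of v4 v1] spn_swap[of v4 v2] spn_swap[of v4 v3] by simp_all
  ultimately show thesis using that by blast
qed

lemma spinorialI:
  assumes "a \<in> gaussian" "b \<in> gaussian" "I \<in> {\<i>, - \<i>}"
    "spn v1 v2 = a\<^sup>2" "spn v2 v3 = b\<^sup>2" "spn v3 v1 = (a + b)\<^sup>2"
    "spn v1 v4 = - (b + (1 + I) * a)\<^sup>2" "spn v2 v4 = (b + I * a)\<^sup>2"
    "spn v3 v4 = ((1 - I) * b + a)\<^sup>2"
  shows "spinorial v1 v2 v3 v4"
  using assms unfolding spinorial_def by blast

lemma spinorial_transpose12: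
  assumes "spinorial v1 v2 v3 v4"
  shows "spinorial v2 v1 v3 v4"
proof -
  obtain a b I where I: "I * I = -1" and mem: "a \<in> gaussian" "b \<in> gaussian" "I \<in> gaussian"
    "- I \<in> {\<i>, - \<i>}"
    and s: "spn v1 v2 = a\<^sup>2" "spn v2 v3 = b\<^sup>2" "spn v3 v1 = (a + b)\<^sup>2"
    "spn v1 v4 = - (b + (1 + I) * a)\<^sup>2" "spn v2 v4 = (b + I * a)\<^sup>2"
    "spn v3 v4 = ((1 - I) * b + a)\<^sup>2"
    "spn v2 v1 = - a\<^sup>2" "spn v3 v2 = - b\<^sup>2" "spn v1 v3 = - (a + b)\<^sup>2"
    "spn v4 v1 = (b + (1 + I) * a)\<^sup>2" "spn v4 v2 = - (b + I * a)\<^sup>2"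
    "spn v4 v3 = - ((1 - I) * b + a)\<^sup>2"
    using assms by (rule spinorialE) blast
  have I': "I * (I * x) = - x" for x using I by (simp add: mult.assoc[symmetric])
  show ?thesis
    \<comment> \<open>The exchange reverses the orientation of the triple, which negates the
      squares; the roots pick up a factor \<open>I\<close>. The signs make the two witnesses add up
      to \<open>- I * b\<close>, a root of \<open>spn v3 v2\<close>.\<close>
    by (rule spinorialI[of "I * a" "- I * (a + b)" "- I"])
      ((use mem in simp; fail) | (simp only: spn_linear s spn_self of_real_numeral; simp add: power2_eq_square algebra_simps I I'))+
qed

lemma spinorial_transpose23:
  assumes "spinorial v1 v2 v3 v4"
  shows "spinorial v1 v3 v2 v4"
proof -
  obtain a b I where I: "I * I = -1" and mem: "a \<in> gaussian" "b \<in> gaussian" "I \<in> gaussian"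
    "- I \<in> {\<i>, - \<i>}"
    and s: "spn v1 v2 = a\<^sup>2" "spn v2 v3 = b\<^sup>2" "spn v3 v1 = (a + b)\<^sup>2"
    "spn v1 v4 = - (b + (1 + I) * a)\<^sup>2" "spn v2 v4 = (b + I * a)\<^sup>2"
    "spn v3 v4 = ((1 - I) * b + a)\<^sup>2"
    "spn v2 v1 = - a\<^sup>2" "spn v3 v2 = - b\<^sup>2" "spn v1 v3 = - (a + b)\<^sup>2"
    "spn v4 v1 = (b + (1 + I) * a)\<^sup>2" "spn v4 v2 = - (b + I * a)\<^sup>2"
    "spn v4 v3 = - ((1 - I) * b + a)\<^sup>2"
    using assms by (rule spinorialE) blast
  have I': "I * (I * x) = - x" for x using I by (simp add: mult.assoc[symmetric])
  show ?thesis
    \<comment> \<open>Again roots of the negated squares, with signs such that the sum is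
      \<open>I * a\<close>, a root of \<open>spn v2 v1\<close>.\<close>
    by (rule spinorialI[of "I * (a + b)" "- I * b" "- I"])
      ((use mem in simp; fail) | (simp only: spn_linear s spn_self of_real_numeral; simp add: power2_eq_square algebra_simps I I'))+
qed

lemma spinorial_transpose34:
  assumes "spinorial v1 v2 v3 v4"
  shows "spinorial v1 v2 v4 v3"
proof -
  obtain a b I where I: "I * I = -1" and mem: "a \<in> gaussian" "b \<in> gaussian" "I \<in> gaussian"
    "- I \<in> {\<i>, - \<i>}"
    and s: "spn v1 v2 = a\<^sup>2" "spn v2 v3 = b\<^sup>2" "spn v3 v1 = (a + b)\<^sup>2"
    "spn v1 v4 = - (b + (1 + I) * a)\<^sup>2" "spn v2 v4 = (b + I * a)\<^sup>2"
    "spn v3 v4 = ((1 - I) * b + a)\<^sup>2"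
    "spn v2 v1 = - a\<^sup>2" "spn v3 v2 = - b\<^sup>2" "spn v1 v3 = - (a + b)\<^sup>2"
    "spn v4 v1 = (b + (1 + I) * a)\<^sup>2" "spn v4 v2 = - (b + I * a)\<^sup>2"
    "spn v4 v3 = - ((1 - I) * b + a)\<^sup>2"
    using assms by (rule spinorialE) blast
  have I': "I * (I * x) = - x" for x using I by (simp add: mult.assoc[symmetric])
  show ?thesis
    \<comment> \<open>The second witness is the old spinor from \<open>v2\<close> to
      \<open>v4\<close>; adding \<open>a\<close> gives the root of \<open>spn v4 v1\<close>.\<close>
    by (rule spinorialI[of "a" "b + I * a" "- I"])
      ((use mem in simp; fail) | (simp only: spn_linear s spn_self of_real_numeral; simp add: power2_eq_square algebra_simps I I'))+
qed

lemma spinorial_conjugate: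
  assumes "spinorial v1 v2 v3 v4"
  shows "spinorial v1 v2 v3 (2 *\<^sub>R (v1 + v2 + v3) - v4)"
proof -
  obtain a b I where I: "I * I = -1" and mem: "a \<in> gaussian" "b \<in> gaussian" "I \<in> gaussian"
    "- I \<in> {\<i>, - \<i>}"
    and s: "spn v1 v2 = a\<^sup>2" "spn v2 v3 = b\<^sup>2" "spn v3 v1 = (a + b)\<^sup>2"
    "spn v1 v4 = - (b + (1 + I) * a)\<^sup>2" "spn v2 v4 = (b + I * a)\<^sup>2"
    "spn v3 v4 = ((1 - I) * b + a)\<^sup>2"
    "spn v2 v1 = - a\<^sup>2" "spn v3 v2 = - b\<^sup>2" "spn v1 v3 = - (a + b)\<^sup>2"
    "spn v4 v1 = (b + (1 + I) * a)\<^sup>2" "spn v4 v2 = - (b + I * a)\<^sup>2"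
    "spn v4 v3 = - ((1 - I) * b + a)\<^sup>2"
    using assms by (rule spinorialE) blast
  have I': "I * (I * x) = - x" for x using I by (simp add: mult.assoc[symmetric])
  show ?thesis
    \<comment> \<open>The first three vectors stay, hence so do \<open>a\<close> and
      \<open>b\<close>; only the choice of \<open>I\<close> changes.\<close>
    by (rule spinorialI[of "a" "b" "- I"])
      ((use mem in simp; fail) | (simp only: spn_linear s spn_self of_real_numeral; simp add: power2_eq_square algebra_simps I I'))+
qed

lemma spinorial_invert:
  assumes "spinorial v1 v2 v3 v4"
  shows "spinorial (v1 + 2 *\<^sub>R v4) (v2 + 2 *\<^sub>R v4) (v3 + 2 *\<^sub>R v4) (- v4)"
proof -
  obtain a b I where I: "I * I = -1" and mem: "a \<in> gaussian" "b \<in> gaussian" "I \<in> gaussian"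
    "- I \<in> {\<i>, - \<i>}"
    and s: "spn v1 v2 = a\<^sup>2" "spn v2 v3 = b\<^sup>2" "spn v3 v1 = (a + b)\<^sup>2"
    "spn v1 v4 = - (b + (1 + I) * a)\<^sup>2" "spn v2 v4 = (b + I * a)\<^sup>2"
    "spn v3 v4 = ((1 - I) * b + a)\<^sup>2"
    "spn v2 v1 = - a\<^sup>2" "spn v3 v2 = - b\<^sup>2" "spn v1 v3 = - (a + b)\<^sup>2"
    "spn v4 v1 = (b + (1 + I) * a)\<^sup>2" "spn v4 v2 = - (b + I * a)\<^sup>2"
    "spn v4 v3 = - ((1 - I) * b + a)\<^sup>2"
    using assms by (rule spinorialE) blast
  have I': "I * (I * x) = - x" for x using I by (simp add: mult.assoc[symmetric])
  show ?thesis
    \<comment> \<open>Bilinearity gives a^2 - 2 (b + (1 + I) a)^2 - 2 (b + I a)^2 for the first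
      pair, which is the perfect square of the first witness. The second arises in the same way from
      the pair \<open>v2\<close>, \<open>v3\<close>.\<close>
    by (rule spinorialI[of "(2 - I) * a - 2 * I * b" "(2 + I) * b + 2 * I * a" "- I"])
      ((use mem in simp; fail) | (simp only: spn_linear s spn_self of_real_numeral; simp add: power2_eq_square algebra_simps I I'))+
qed

section \<open>Integral configurations with Gaussian spinors\<close>

definition lattice_config :: "lvec \<Rightarrow> lvec \<Rightarrow> lvec \<Rightarrow> lvec \<Rightarrow> bool" where
  "lattice_config v1 v2 v3 v4 \<longleftrightarrow> gram v1 v2 v3 v4 \<and> spinorial v1 v2 v3 v4 \<and>
     integral_symbol v1 \<and> integral_symbol v2 \<and> integral_symbol v3 \<and> integral_symbol v4"

text \<open>Adjacent transpositions generate all permutations, so any disk may be brought to the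
  fourth place, where the moves act.\<close>

lemma lattice_config_transpose:
  assumes "lattice_config v1 v2 v3 v4"
  shows "lattice_config v2 v1 v3 v4" "lattice_config v1 v3 v2 v4" "lattice_config v1 v2 v4 v3"
proof -
  have g: "gram v1 v2 v3 v4" using assms by (simp add: lattice_config_def)
  have "gram v2 v1 v3 v4" "gram v1 v3 v2 v4" "gram v1 v2 v4 v3"
    unfolding gram_def by (simp_all add: gram_all[OF g])
  then show "lattice_config v2 v1 v3 v4" "lattice_config v1 v3 v2 v4" "lattice_config v1 v2 v4 v3"
    using assms spinorial_transpose12[of v1 v2 v3 v4] spinorial_transpose23[of v1 v2 v3 v4]
      spinorial_transpose34[of v1 v2 v3 v4]
    unfolding lattice_config_def by simp_all
qed

lemma lattice_config_conjugate:
  assumes "lattice_config v1 v2 v3 v4"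
  shows "lattice_config v1 v2 v3 (2 *\<^sub>R (v1 + v2 + v3) - v4)"
proof -
  have g: "gram v1 v2 v3 v4" using assms by (simp add: lattice_config_def)
  then have "gram v1 v2 v3 (2 *\<^sub>R (v1 + v2 + v3) - v4)"
    unfolding gram_def[of _ _ _ "_ - _"] by (simp add: gram_all[OF g])
  then show ?thesis using assms spinorial_conjugate[of v1 v2 v3 v4] unfolding lattice_config_def by blast
qed

lemma lattice_config_invert:
  assumes "lattice_config v1 v2 v3 v4"
  shows "lattice_config (v1 + 2 *\<^sub>R v4) (v2 + 2 *\<^sub>R v4) (v3 + 2 *\<^sub>R v4) (- v4)"
proof -
  have g: "gram v1 v2 v3 v4" using assms by (simp add: lattice_config_def)
  then have "gram (v1 + 2 *\<^sub>R v4) (v2 + 2 *\<^sub>R v4) (v3 + 2 *\<^sub>R v4) (- v4)"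
    unfolding gram_def[of _ _ _ "- _"] by (simp add: gram_all[OF g])
  then show ?thesis using assms spinorial_invert[of v1 v2 v3 v4] unfolding lattice_config_def by blast
qed

section \<open>Descent on integral curvature quadruples\<close>

definition realizable :: "int \<Rightarrow> int \<Rightarrow> int \<Rightarrow> int \<Rightarrow> bool" where
  "realizable a b c d \<longleftrightarrow> (\<exists>v1 v2 v3 v4. lattice_config v1 v2 v3 v4 \<and>
     fst (snd v1) = of_int a \<and> fst (snd v2) = of_int b \<and>
     fst (snd v3) = of_int c \<and> fst (snd v4) = of_int d)"

lemma realizable_transpose:
  assumes "realizable a b c d"
  shows "realizable b a c d" "realizable a c b d" "realizable a b d c"
proof -
  obtain v1 v2 v3 v4 where v: "lattice_config v1 v2 v3 v4"
    "fst (snd v1) = of_int a" "fst (snd v2) = of_int b" "fst (snd v3) = of_int c" "fst (snd v4) = of_int d"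
    using assms unfolding realizable_def by blast
  show "realizable b a c d" "realizable a c b d" "realizable a b d c"
    unfolding realizable_def
    using v(2-) lattice_config_transpose(1)[OF v(1)] apply blast
    using v(2-) lattice_config_transpose(2)[OF v(1)] apply blast
    using v(2-) lattice_config_transpose(3)[OF v(1)] by blast
qed

text \<open>Stated in the direction that undoes a descent step; conjugation is an involution, so
  applying it again restores \<open>d\<close>.\<close>

lemma realizable_conjugate:
  assumes "realizable a b c (2 * (a + b + c) - d)"
  shows "realizable a b c d"
proof -
  obtain v1 v2 v3 v4 where v: "lattice_config v1 v2 v3 v4"
    "fst (snd v1) = of_int a" "fst (snd v2) = of_int b" "fst (snd v3) = of_int c"
    "fst (snd v4) = of_int (2 * (a + b + c) - d)"
    using assms unfolding realizable_def by blast
  have "fst (snd (2 *\<^sub>R (v1 + v2 + v3) - v4)) = of_int d" by (simp add: v)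
  then show ?thesis using lattice_config_conjugate[OF v(1)] v unfolding realizable_def by blast
qed

text \<open>Geometrically: inversion of the whole configuration in the boundary of its fourth disk.\<close>
lemma realizable_invert:
  assumes "realizable (a + 2 * d) (b + 2 * d) (c + 2 * d) (- d)"
  shows "realizable a b c d"
proof -
  obtain v1 v2 v3 v4 where v: "lattice_config v1 v2 v3 v4"
    "fst (snd v1) = of_int (a + 2 * d)" "fst (snd v2) = of_int (b + 2 * d)"
    "fst (snd v3) = of_int (c + 2 * d)" "fst (snd v4) = of_int (- d)"
    using assms unfolding realizable_def by blast
  have "fst (snd (v1 + 2 *\<^sub>R v4)) = of_int a" "fst (snd (v2 + 2 *\<^sub>R v4)) = of_int b"
    "fst (snd (v3 + 2 *\<^sub>R v4)) = of_int c" "fst (snd (- v4)) = of_int d" by (simp_all add: v)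
  then show ?thesis using lattice_config_invert[OF v(1)] unfolding realizable_def by blast
qed

text \<open>The half-planes \<open>x \<ge> 1\<close>, \<open>x \<le> -1\<close> and the unit disks centred at \<open>0\<close> and \<open>2i\<close>.\<close>
lemma realizable_strip: "realizable 0 0 1 1"
proof -
  let ?v1 = "(1, 0, 2) :: lvec" and ?v2 = "(-1, 0, 2) :: lvec"
  let ?v3 = "(0, 1, -1) :: lvec" and ?v4 = "(2 * \<i>, 1, 3) :: lvec"
  have "gram ?v1 ?v2 ?v3 ?v4" by (simp add: gram_def lip_def inner_complex_def)
  moreover have "spinorial ?v1 ?v2 ?v3 ?v4"
    \<comment> \<open>\<open>a = 0\<close> because both half-planes have curvature 0. The spinor
      square of \<open>?v3\<close>, \<open>?v4\<close> is 2i = (1 + i)^2, which forces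
      \<open>I = - \<i>\<close>.\<close>
    by (rule spinorialI[of 0 1 "- \<i>"]) (simp_all add: spn_def power2_eq_square algebra_simps)
  moreover have "integral_symbol ?v1" "integral_symbol ?v2" "integral_symbol ?v3" "integral_symbol ?v4"
    by (simp_all add: integral_symbol_def)
  ultimately have "lattice_config ?v1 ?v2 ?v3 ?v4" unfolding lattice_config_def by blast
  then show ?thesis unfolding realizable_def by (intro exI conjI) (assumption | simp)+
qed

text \<open>Descartes' equation is unchanged when all entries are negated; the positive sum fixes
  the sign.\<close>

definition descartes_quad :: "int \<Rightarrow> int \<Rightarrow> int \<Rightarrow> int \<Rightarrow> bool" where
  "descartes_quad a b c d \<longleftrightarrow> 2 * (a\<^sup>2 + b\<^sup>2 + c\<^sup>2 + d\<^sup>2) = (a + b + c + d)\<^sup>2 \<and>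
     a + b + c + d > 0 \<and> (\<forall>k. k dvd a \<longrightarrow> k dvd b \<longrightarrow> k dvd c \<longrightarrow> k dvd d \<longrightarrow> k dvd 1)"

lemma descartes_quad_transpose:
  assumes "descartes_quad a b c d"
  shows "descartes_quad b a c d" "descartes_quad a c b d" "descartes_quad a b d c"
  using assms unfolding descartes_quad_def by (simp_all add: ac_simps)

text \<open>Cauchy-Schwarz against (1, 1, 1); it keeps the sum of the curvatures positive under both
  moves.\<close>

lemma three_squares_ge:
  fixes a b c :: int
  shows "(a + b + c)\<^sup>2 \<le> 3 * (a\<^sup>2 + b\<^sup>2 + c\<^sup>2)"
proof -
  have "3 * (a\<^sup>2 + b\<^sup>2 + c\<^sup>2) - (a + b + c)\<^sup>2 = (a - b)\<^sup>2 + (b - c)\<^sup>2 + (a - c)\<^sup>2"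
    by (simp add: power2_eq_square algebra_simps)
  moreover have "\<dots> \<ge> 0" by simp
  ultimately show ?thesis by linarith
qed

lemma descartes_quad_conjugate:
  assumes "descartes_quad a b c d"
  shows "descartes_quad a b c (2 * (a + b + c) - d)"
proof -
  define t where "t = a + b + c"
  have n: "2 * (a\<^sup>2 + b\<^sup>2 + c\<^sup>2) + 2 * d\<^sup>2 = (t + d)\<^sup>2" and p: "t + d > 0"
    and k: "\<And>k. k dvd a \<Longrightarrow> k dvd b \<Longrightarrow> k dvd c \<Longrightarrow> k dvd d \<Longrightarrow> k dvd 1"
    using assms by (auto simp: descartes_quad_def t_def algebra_simps)
  have "2 * (a\<^sup>2 + b\<^sup>2 + c\<^sup>2 + (2 * t - d)\<^sup>2) = (t + (2 * t - d))\<^sup>2"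
    using n by (simp add: power2_eq_square algebra_simps)
  \<comment> \<open>This is the sum of the new quadruple. Otherwise \<open>d\<close> is positive and
    at least \<open>3 * t\<close>, the equation yields d^2 \<le> t^2, and yet \<open>d\<close>
    exceeds the absolute value of \<open>t\<close>.\<close>
  moreover have "3 * t - d > 0"
  proof (rule ccontr)
    assume "\<not> ?thesis"
    then have h: "d \<ge> 3 * t" by simp
    then have d: "d > 0" using p by simp
    have "2 * t\<^sup>2 + 6 * d\<^sup>2 \<le> 3 * (t + d)\<^sup>2"
      using three_squares_ge[of a b c] n unfolding t_def[symmetric] by linarith
    then have "3 * d\<^sup>2 \<le> 6 * (t * d) + t\<^sup>2" by (simp add: power2_eq_square algebra_simps)
    moreover have "3 * (t * d) \<le> d\<^sup>2" using h d by (simp add: power2_eq_square mult.assoc[symmetric])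
    ultimately have le: "d\<^sup>2 \<le> t\<^sup>2" by linarith
    have "t > 0 \<or> t \<le> 0" by linarith
    then show False
    proof
      assume "t > 0"
      then have "t < d" using h by simp
      then have "\<bar>t\<bar> < \<bar>d\<bar>" using \<open>t > 0\<close> by simp
      then show False using le by (simp add: abs_le_square_iff[symmetric])
    next
      assume "t \<le> 0"
      then have "\<bar>t\<bar> < \<bar>d\<bar>" using p d by simp
      then show False using le by (simp add: abs_le_square_iff[symmetric])
    qed
  qed
  moreover have "k dvd 1" if "k dvd a" "k dvd b" "k dvd c" "k dvd 2 * t - d" for k
  proof (rule k[OF that(1-3)])
    have "k dvd 2 * t" using that by (simp add: t_def)
    then have "k dvd 2 * t - (2 * t - d)" using that(4) dvd_diff by blast
    then show "k dvd d" by simp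
  qed
  ultimately show ?thesis unfolding descartes_quad_def t_def[symmetric] by (simp add: algebra_simps)
qed

lemma descartes_quad_invert:
  assumes "descartes_quad a b c d"
  shows "descartes_quad (a + 2 * d) (b + 2 * d) (c + 2 * d) (- d)"
proof -
  define s where "s = a + b + c + d"
  have n: "2 * (a\<^sup>2 + b\<^sup>2 + c\<^sup>2) + 2 * d\<^sup>2 = s\<^sup>2" and p: "s > 0"
    and k: "\<And>k. k dvd a \<Longrightarrow> k dvd b \<Longrightarrow> k dvd c \<Longrightarrow> k dvd d \<Longrightarrow> k dvd 1"
    using assms by (auto simp: descartes_quad_def s_def)
  have "2 * ((a + 2 * d)\<^sup>2 + (b + 2 * d)\<^sup>2 + (c + 2 * d)\<^sup>2 + (- d)\<^sup>2) = (s + 4 * d)\<^sup>2"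
  proof -
    have "2 * ((a + 2 * d)\<^sup>2 + (b + 2 * d)\<^sup>2 + (c + 2 * d)\<^sup>2 + (- d)\<^sup>2)
        = (2 * (a\<^sup>2 + b\<^sup>2 + c\<^sup>2) + 2 * d\<^sup>2) + 8 * d * s + 16 * d\<^sup>2"
      by (simp add: s_def power2_eq_square algebra_simps)
    also have "\<dots> = (s + 4 * d)\<^sup>2" unfolding n by (simp add: power2_eq_square algebra_simps)
    finally show ?thesis .
  qed
  \<comment> \<open>This is the sum of the new quadruple. Otherwise 4 s d \<le> - s^2 and 8 d^2
    \<le> 4 s d + s^2 force \<open>d = 0\<close>, against \<open>s > 0\<close>.\<close>
  moreover have "s + 4 * d > 0"
  proof (rule ccontr)
    assume "\<not> ?thesis"
    then have h: "s + 4 * d \<le> 0" by simp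
    have "2 * (s - d)\<^sup>2 + 6 * d\<^sup>2 \<le> 3 * s\<^sup>2"
      using three_squares_ge[of a b c] n by (simp add: s_def)
    then have "8 * d\<^sup>2 \<le> 4 * (s * d) + s\<^sup>2" by (simp add: power2_eq_square algebra_simps)
    moreover have "s * (4 * d) \<le> s * (- s)" using h p by (intro mult_left_mono) auto
    ultimately have "8 * d\<^sup>2 \<le> 0" by (simp add: power2_eq_square algebra_simps)
    then show False using h p by simp
  qed
  moreover have "k dvd 1" if "k dvd a + 2 * d" "k dvd b + 2 * d" "k dvd c + 2 * d" "k dvd - d" for k
    using that by (intro k) (simp_all add: dvd_add_left_iff)
  ultimately show ?thesis unfolding descartes_quad_def s_def by (simp add: algebra_simps)
qed

text \<open>Induction on the sum \<open>s\<close>. Inverting at an entry \<open>w < 0\<close>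
  changes it to \<open>s + 4 * w\<close>, conjugating at \<open>2 * w > s\<close> to
  \<open>3 * s - 4 * w\<close>; both are smaller. If neither applies, the quadruple is a permutation
  of (0, 0, 1, 1).\<close>

lemma realizable_descartes_quad:
  "descartes_quad a b c d \<Longrightarrow> realizable a b c d"
proof (induction "nat (a + b + c + d)" arbitrary: a b c d rule: less_induct)
  case less
  define s where "s = a + b + c + d"
  have key: "realizable x y z w"
    if q: "descartes_quad x y z w" and s: "x + y + z + w = s" and w: "w < 0 \<or> 2 * w > s" for x y z w
    using w
  proof
    assume "w < 0"
    moreover have "descartes_quad (x + 2 * w) (y + 2 * w) (z + 2 * w) (- w)"
      using q by (rule descartes_quad_invert)
    ultimately have "realizable (x + 2 * w) (y + 2 * w) (z + 2 * w) (- w)"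
      using s by (intro less.hyps) (auto simp: s_def[symmetric] descartes_quad_def)
    then show ?thesis by (rule realizable_invert)
  next
    assume "2 * w > s"
    moreover have "descartes_quad x y z (2 * (x + y + z) - w)"
      using q by (rule descartes_quad_conjugate)
    ultimately have "realizable x y z (2 * (x + y + z) - w)"
      using s by (intro less.hyps) (auto simp: s_def[symmetric] descartes_quad_def)
    then show ?thesis by (rule realizable_conjugate)
  qed
  note dt = descartes_quad_transpose and rt = realizable_transpose
  consider "d < 0 \<or> 2 * d > s" | "c < 0 \<or> 2 * c > s" | "b < 0 \<or> 2 * b > s" | "a < 0 \<or> 2 * a > s"
    | "0 \<le> a" "0 \<le> b" "0 \<le> c" "0 \<le> d" "2 * a \<le> s" "2 * b \<le> s" "2 * c \<le> s" "2 * d \<le> s"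
    by linarith
  then show ?case
  proof cases
    case 1 then show ?thesis using key less.prems s_def by blast
  next
    case 2
    have "realizable a b d c" by (rule key) (use 2 dt(3)[OF less.prems] s_def in auto)
    then show ?thesis by (rule rt)
  next
    case 3
    have "realizable a c d b"
      by (rule key) (use 3 dt(3)[OF dt(2)[OF less.prems]] s_def in auto)
    from rt(2)[OF rt(3)[OF this]] show ?thesis .
  next
    case 4
    have "realizable b c d a"
      by (rule key) (use 4 dt(3)[OF dt(2)[OF dt(1)[OF less.prems]]] s_def in auto)
    from rt(1)[OF rt(2)[OF rt(3)[OF this]]] show ?thesis .
  next
    case 5
    have n: "2 * (a\<^sup>2 + b\<^sup>2 + c\<^sup>2 + d\<^sup>2) = s\<^sup>2" and p: "s > 0"
      and k: "\<And>k. k dvd a \<Longrightarrow> k dvd b \<Longrightarrow> k dvd c \<Longrightarrow> k dvd d \<Longrightarrow> k dvd 1"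
      using less.prems by (auto simp: descartes_quad_def s_def)
    \<comment> \<open>Descartes' equation makes this sum of four nonnegative terms vanish, so each
      entry is 0 or \<open>s / 2\<close>.\<close>
    have "a * (s - 2 * a) + b * (s - 2 * b) + c * (s - 2 * c) + d * (s - 2 * d)
        = (a + b + c + d) * s - 2 * (a\<^sup>2 + b\<^sup>2 + c\<^sup>2 + d\<^sup>2)"
      by (simp add: power2_eq_square algebra_simps)
    also have "\<dots> = 0" unfolding n s_def by (simp add: power2_eq_square)
    finally have "a * (s - 2 * a) + b * (s - 2 * b) + c * (s - 2 * c) + d * (s - 2 * d) = 0" .
    moreover have "a * (s - 2 * a) \<ge> 0" "b * (s - 2 * b) \<ge> 0" "c * (s - 2 * c) \<ge> 0" "d * (s - 2 * d) \<ge> 0"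
      using 5 by simp_all
    ultimately have "a * (s - 2 * a) = 0" "b * (s - 2 * b) = 0" "c * (s - 2 * c) = 0" "d * (s - 2 * d) = 0"
      by linarith+
    then have z: "a = 0 \<or> 2 * a = s" "b = 0 \<or> 2 * b = s" "c = 0 \<or> 2 * c = s" "d = 0 \<or> 2 * d = s"
      by auto
    \<comment> \<open>Since \<open>s > 0\<close>, some entry is nonzero and equals half of
      \<open>s\<close>. This half divides every entry, so primitivity makes it 1.\<close>
    then obtain m where m: "s = 2 * m" using p s_def by (metis add.right_neutral less_irrefl)
    have "m dvd 1" using z m by (intro k) auto
    then have "m = 1" using p m by simp
    then have "a = 0 \<or> a = 1" "b = 0 \<or> b = 1" "c = 0 \<or> c = 1" "d = 0 \<or> d = 1" "a + b + c + d = 2"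
      using z m s_def by auto
    moreover have "realizable 0 1 0 1" using rt(2)[OF realizable_strip] .
    moreover have "realizable 0 1 1 0" using rt(3)[OF rt(2)[OF realizable_strip]] .
    moreover have "realizable 1 0 0 1" using rt(1)[OF rt(2)[OF realizable_strip]] .
    moreover have "realizable 1 0 1 0" using rt(3)[OF rt(1)[OF rt(2)[OF realizable_strip]]] .
    moreover have "realizable 1 1 0 0" using rt(2)[OF rt(3)[OF rt(1)[OF rt(2)[OF realizable_strip]]]] .
    ultimately show ?thesis using realizable_strip by auto
  qed
qed

section \<open>Descartes moves\<close>

text \<open>Keeps only the Lorentz products of a Descartes configuration, so that moves become pure
  linear algebra.\<close>

definition tangent_quad :: "gdisk set \<Rightarrow> bool" where
  "tangent_quad Q \<longleftrightarrow> card Q = 4 \<and> (\<forall>A\<in>Q. wf_disk A) \<and>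
     (\<forall>A\<in>Q. \<forall>B\<in>Q. A \<noteq> B \<longrightarrow> lip (symb A) (symb B) = -1)"

text \<open>Conjugation in a form symmetric in \<open>A\<close> and \<open>A'\<close>. Reversibility
  allows passing between any two configurations of the packing.\<close>

definition swap :: "gdisk \<Rightarrow> gdisk \<Rightarrow> gdisk set \<Rightarrow> gdisk set \<Rightarrow> bool" where
  "swap A A' Q Q' \<longleftrightarrow> tangent_quad Q \<and> tangent_quad Q' \<and> A \<in> Q \<and> A' \<notin> Q \<and>
     Q' = insert A' (Q - {A}) \<and> symb A + symb A' = 2 *\<^sub>R (\<Sum>B\<in>Q - {A}. symb B)"

lemma tangent_quad_descartes: "descartes_config Q \<Longrightarrow> tangent_quad Q"
  using tangent_imp_lip unfolding descartes_config_def tangent_quad_def by blast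

lemma tangent_quadE:
  assumes "tangent_quad Q" "A \<in> Q"
  obtains B C D where "Q - {A} = {B, C, D}" "distinct [B, C, D, A]" "Q = {B, C, D, A}"
    "gram (symb B) (symb C) (symb D) (symb A)"
proof -
  have "card (Q - {A}) = 3" using assms by (simp add: tangent_quad_def)
  then obtain B C D where *: "Q - {A} = {B, C, D}" "B \<noteq> C" "C \<noteq> D" "B \<noteq> D" by (metis card_3_iff)
  then have d: "distinct [B, C, D, A]" and Q: "Q = {B, C, D, A}" using assms by auto
  have "gram (symb B) (symb C) (symb D) (symb A)"
    using assms(1) d unfolding tangent_quad_def gram_def Q by (auto simp: lip_symb_self)
  then show ?thesis using that * d Q by blast
qed

lemma swap_sym: "swap A A' Q Q' \<Longrightarrow> swap A' A Q' Q"
  unfolding swap_def by (auto simp: add.commute insert_absorb)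

lemma swap_determ:
  assumes "swap A B Q Q'" "swap A B' Q Q''"
  shows "B = B'" "Q' = Q''"
proof -
  have "symb B = symb B'" using assms unfolding swap_def by (metis add_left_cancel)
  moreover have "wf_disk B" "wf_disk B'" using assms by (auto simp: swap_def tangent_quad_def)
  ultimately show "B = B'" by (metis inj_symb)
  then show "Q' = Q''" using assms by (simp add: swap_def)
qed

text \<open>The three tangencies fix three products of the new symbol, and its self-product is 1, so
  \<open>conjugate_unique\<close> leaves only the linear conjugate.\<close>

lemma descartes_step_swap:
  assumes Q: "tangent_quad Q" and "descartes_step Q Q'"
  obtains A A' where "swap A A' Q Q'"
proof -
  obtain A A' where A: "A \<in> Q" "wf_disk A'" "A' \<noteq> A" "\<forall>B\<in>Q - {A}. tangent A' B"
    and Q': "Q' = insert A' (Q - {A})"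
    using assms unfolding descartes_step_def by blast
  obtain B C D where *: "Q - {A} = {B, C, D}" "distinct [B, C, D, A]" "Q = {B, C, D, A}"
    "gram (symb B) (symb C) (symb D) (symb A)"
    using tangent_quadE[OF Q A(1)] .
  have wf: "wf_disk A" using A(1) Q by (simp add: tangent_quad_def)
  have l: "lip (symb A') (symb B) = -1" "lip (symb A') (symb C) = -1" "lip (symb A') (symb D) = -1"
    using A(4) tangent_imp_lip unfolding *(1) by blast+
  have s: "lip (symb X) (symb X) = 1" if "X \<in> insert A' Q" for X
  proof (rule lip_symb_self)
    show "wf_disk X" using that A(2) Q unfolding tangent_quad_def by blast
  qed
  have "A' \<noteq> B" "A' \<noteq> C" "A' \<noteq> D" using l s[of A'] by auto
  then have "A' \<notin> Q" using A(3) *(3) by simp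
  moreover have "symb A' = 2 *\<^sub>R (symb B + symb C + symb D) - symb A"
    using conjugate_unique[OF *(4) l] s[of A'] A(3) inj_symb[OF A(2) wf] by blast
  then have "symb A + symb A' = 2 *\<^sub>R (\<Sum>X\<in>Q - {A}. symb X)" using *(1,2) by (simp add: add.assoc)
  moreover have "tangent_quad Q'"
    unfolding tangent_quad_def
  proof (intro conjI ballI impI)
    show "card Q' = 4" using \<open>A' \<notin> Q\<close> *(2,3) unfolding Q' *(1) by simp
    show "wf_disk X" if "X \<in> Q'" for X using that A Q by (auto simp: Q' tangent_quad_def)
    show "lip (symb X) (symb Y) = -1" if "X \<in> Q'" "Y \<in> Q'" "X \<noteq> Y" for X Y
    proof -
      have "lip (symb A') (symb Z) = -1" if "Z \<in> Q - {A}" for Z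
        using A(4) that tangent_imp_lip by blast
      then show ?thesis
        using that Q by (auto simp: Q' tangent_quad_def lip_commute[of _ "symb A'"])
    qed
  qed
  ultimately show thesis using that Q A Q' unfolding swap_def by blast
qed

lemma swap_lip:
  assumes "swap A A' Q Q'"
  shows "lip v (symb A) + lip v (symb A') = 2 * (\<Sum>B\<in>Q - {A}. lip v (symb B))"
  using assms lip_linear(2)[of v "symb A" "symb A'"] by (simp add: swap_def lip_sum)

section \<open>Words without backtracking and tangent pairs\<close>

text \<open>Configurations reached from \<open>Q\<^sub>0\<close> by words without backtracking; the option records the disk
  created by the last move.\<close>
inductive reduced :: "gdisk set \<Rightarrow> gdisk option \<Rightarrow> gdisk set \<Rightarrow> bool" for Q\<^sub>0 where
  reduced_refl: "reduced Q\<^sub>0 None Q\<^sub>0"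
| reduced_step: "reduced Q\<^sub>0 x Q \<Longrightarrow> swap A A' Q Q' \<Longrightarrow> x \<noteq> Some A \<Longrightarrow> reduced Q\<^sub>0 (Some A') Q'"

text \<open>A move that removes the newest disk undoes the last move and shortens the word; any
  other move extends it. Hence words without backtracking reach everything.\<close>

lemma reduced_swap:
  assumes "reduced Q\<^sub>0 x Q" "swap A A' Q Q'"
  shows "\<exists>y. reduced Q\<^sub>0 y Q'"
proof (cases "x = Some A")
  case True
  with assms(1) show ?thesis
  proof cases
    case (reduced_step y P B)
    then have "swap A B Q P" using True swap_sym by blast
    then have "Q' = P" using assms(2) swap_determ by blast
    then show ?thesis using reduced_step by blast
  qed simp
qed (use assms reduced.reduced_step in blast)

text \<open>As long as \<open>A\<^sub>0\<close> is present, the products of \<open>- A\<^sub>0\<close> with the four disks are \<open>-1, 1, 1, 1\<close>;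
  replacing \<open>A\<^sub>0\<close> creates the value \<open>7\<close>, and from then on the newest value is the largest.\<close>
lemma reduced_invariant:
  assumes "reduced Q\<^sub>0 x Q" "tangent_quad Q\<^sub>0" "A\<^sub>0 \<in> Q\<^sub>0"
  defines "L \<equiv> \<lambda>B. - lip (symb A\<^sub>0) (symb B)"
  shows "tangent_quad Q \<and> (A\<^sub>0 \<in> Q \<or> (\<exists>D\<in>Q. x = Some D \<and> L D \<ge> 7 \<and> (\<forall>B\<in>Q. 0 \<le> L B \<and> L B \<le> L D)))"
  using assms(1)
proof (induction rule: reduced.induct)
  case reduced_refl
  then show ?case using assms by simp
next
  case (reduced_step x Q A A' Q')
  have Q': "tangent_quad Q'" "A \<in> Q" "Q' = insert A' (Q - {A})" and tq: "tangent_quad Q"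
    using reduced_step.hyps by (auto simp: swap_def)
  obtain B C D where *: "Q - {A} = {B, C, D}" "distinct [B, C, D, A]" "Q = {B, C, D, A}"
    "gram (symb B) (symb C) (symb D) (symb A)"
    using tangent_quadE[OF tq Q'(2)] .
  have L: "L A + L A' = 2 * (L B + L C + L D)"
    using swap_lip[OF reduced_step.hyps(2), of "symb A\<^sub>0"] * by (simp add: L_def)
  have "A\<^sub>0 \<in> Q' \<or> (L A' \<ge> 7 \<and> (\<forall>B\<in>Q'. 0 \<le> L B \<and> L B \<le> L A'))"
  proof (cases "A\<^sub>0 \<in> Q")
    case True
    show ?thesis
    proof (cases "A = A\<^sub>0")
      case True
      \<comment> \<open>The recurrence gives 2 * 3 + 1 = 7 for the new disk.\<close>
      then have "L A = -1" "L B = 1" "L C = 1" "L D = 1" using gram_all[OF *(4)] by (simp_all add: L_def)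
      then show ?thesis using L * Q' by auto
    qed (use True Q' in auto)
  next
    case False
    then obtain M where M: "M \<in> Q" "x = Some M" "L M \<ge> 7" "\<forall>B\<in>Q. 0 \<le> L B \<and> L B \<le> L M"
      using reduced_step.IH by blast
    \<comment> \<open>Without backtracking the newest disk \<open>M\<close>, of largest value, is
      kept, so \<open>L A' \<ge> 2 * L M - L A \<ge> L M\<close>.\<close>
    then have "M \<in> {B, C, D}" using reduced_step.hyps(3) * by auto
    moreover have "0 \<le> L B" "0 \<le> L C" "0 \<le> L D" "L A \<le> L M" using M * by auto
    ultimately have "L M \<le> L A'" using L by auto
    then show ?thesis using M Q' by force
  qed
  then show ?case using Q' by auto
qed

text \<open>If \<open>A\<close> is missing, the newest disk has product at most -7 with it and so is
  not \<open>B\<close>. Thus \<open>B\<close> was present one move earlier, and going back ends at a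
  configuration that contains \<open>A\<close>.\<close>

lemma reduced_tangent_pair:
  assumes "reduced Q\<^sub>0 x Q" "tangent_quad Q\<^sub>0" "A \<in> Q\<^sub>0" "B \<in> Q" "lip (symb A) (symb B) = -1"
  shows "\<exists>y Q'. reduced Q\<^sub>0 y Q' \<and> A \<in> Q' \<and> B \<in> Q'"
  using assms(1,4)
proof (induction rule: reduced.induct)
  case reduced_refl
  then show ?case using assms(3) reduced.reduced_refl by blast
next
  case (reduced_step x Q C C' Q')
  have r: "reduced Q\<^sub>0 (Some C') Q'" using reduced_step.hyps by (rule reduced.reduced_step)
  show ?case
  proof (cases "A \<in> Q'")
    case True
    then show ?thesis using r reduced_step.prems by blast
  next
    case False
    then have "- lip (symb A) (symb C') \<ge> 7"
      using reduced_invariant[OF r assms(2,3)] by auto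
    then have "B \<noteq> C'" using assms(5) by auto
    then have "B \<in> Q" using reduced_step by (auto simp: swap_def)
    then show ?thesis by (rule reduced_step.IH)
  qed
qed

definition swaps :: "gdisk set \<Rightarrow> gdisk set \<Rightarrow> bool" where
  "swaps Q Q' \<longleftrightarrow> (\<exists>A A'. swap A A' Q Q')"

lemma swaps_rtranclp_sym: "swaps\<^sup>*\<^sup>* Q Q' \<Longrightarrow> swaps\<^sup>*\<^sup>* Q' Q"
proof (induction rule: rtranclp_induct)
  case (step Q' Q'')
  then have "swaps Q'' Q'" using swap_sym unfolding swaps_def by blast
  then show ?case using step.IH by (rule converse_rtranclp_into_rtranclp)
qed simp

lemma descartes_steps_swaps:
  assumes "descartes_step\<^sup>*\<^sup>* Q Q'" "tangent_quad Q"
  shows "swaps\<^sup>*\<^sup>* Q Q' \<and> tangent_quad Q'"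
  using assms(1)
proof (induction rule: rtranclp_induct)
  case (step Q' Q'')
  then obtain A A' where s: "swap A A' Q' Q''" using descartes_step_swap by blast
  then have "swaps Q' Q''" "tangent_quad Q''" by (auto simp: swaps_def swap_def)
  then show ?case using step.IH by (meson rtranclp.rtrancl_into_rtrancl)
qed (use assms in simp)

lemma reduced_swaps: "reduced Q x Q' \<Longrightarrow> swaps\<^sup>*\<^sup>* Q Q'"
  by (induction rule: reduced.induct) (auto simp: swaps_def intro: rtranclp.rtrancl_into_rtrancl)

lemma swaps_reduced: "swaps\<^sup>*\<^sup>* Q Q' \<Longrightarrow> \<exists>x. reduced Q x Q'"
proof (induction rule: rtranclp_induct)
  case base
  then show ?case using reduced.reduced_refl by blast
next
  case (step Q' Q'')
  then show ?case using reduced_swap unfolding swaps_def by blast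
qed

lemma tangent_pair_common:
  assumes "tangent_quad Q" "A \<in> apollonian_packing Q" "B \<in> apollonian_packing Q" "tangent A B"
  obtains Q' where "swaps\<^sup>*\<^sup>* Q Q'" "A \<in> Q'" "B \<in> Q'"
proof -
  obtain Q1 Q2 where "descartes_step\<^sup>*\<^sup>* Q Q1" "A \<in> Q1" "descartes_step\<^sup>*\<^sup>* Q Q2" "B \<in> Q2"
    using assms by (auto simp: apollonian_packing_def)
  then have Q1: "swaps\<^sup>*\<^sup>* Q Q1" "tangent_quad Q1" "A \<in> Q1" and Q2: "swaps\<^sup>*\<^sup>* Q Q2" "B \<in> Q2"
    using descartes_steps_swaps[OF _ assms(1)] by auto
  \<comment> \<open>Reversing the path to \<open>Q1\<close> makes it the new starting point, so that
    \<open>A\<close> belongs to the base of the word.\<close>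
  have "swaps\<^sup>*\<^sup>* Q1 Q2" using swaps_rtranclp_sym[OF Q1(1)] Q2(1) by (rule rtranclp_trans)
  then obtain x where x: "reduced Q1 x Q2" using swaps_reduced by blast
  have "lip (symb A) (symb B) = -1" using tangent_imp_lip[OF assms(4)] by blast
  then obtain y Q' where "reduced Q1 y Q'" "A \<in> Q'" "B \<in> Q'"
    using reduced_tangent_pair[OF x Q1(2,3) Q2(2)] by blast
  moreover from this have "swaps\<^sup>*\<^sup>* Q Q'" using Q1(1) reduced_swaps by (meson rtranclp_trans)
  ultimately show ?thesis using that by blast
qed

section \<open>Integrality and Gaussian spinors throughout the packing\<close>

definition lattice_quad :: "gdisk set \<Rightarrow> bool" where
  "lattice_quad Q \<longleftrightarrow> (\<exists>A B C D. Q = {A, B, C, D} \<and> distinct [A, B, C, D] \<and>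
     lattice_config (symb A) (symb B) (symb C) (symb D))"

text \<open>Permutation invariance of \<open>lattice_config\<close> brings a chosen disk to the last
  place of the ordering.\<close>

lemma lattice_quadE:
  assumes "lattice_quad Q" "A \<in> Q"
  obtains B C D where "Q = {B, C, D, A}" "distinct [B, C, D, A]"
    "lattice_config (symb B) (symb C) (symb D) (symb A)"
proof -
  obtain X Y Z W where Q: "Q = {X, Y, Z, W}" and d: "distinct [X, Y, Z, W]"
    and l: "lattice_config (symb X) (symb Y) (symb Z) (symb W)"
    using assms by (auto simp: lattice_quad_def)
  note t = lattice_config_transpose
  consider "A = W" | "A = Z" | "A = Y" | "A = X" using Q assms by blast
  then show thesis
  proof cases
    case 1 show ?thesis by (rule that[of X Y Z]) (use 1 Q d l in auto)
  next
    case 2 show ?thesis by (rule that[of X Y W]) (use 2 Q d t(3)[OF l] in auto)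
  next
    case 3 show ?thesis by (rule that[of X Z W]) (use 3 Q d t(3)[OF t(2)[OF l]] in auto)
  next
    case 4 show ?thesis by (rule that[of Y Z W]) (use 4 Q d t(3)[OF t(2)[OF t(1)[OF l]]] in auto)
  qed
qed

lemma lattice_quad_swap:
  assumes "lattice_quad Q" "swap A A' Q Q'"
  shows "lattice_quad Q'"
proof -
  have A: "A \<in> Q" "A' \<notin> Q" "Q' = insert A' (Q - {A})" using assms by (auto simp: swap_def)
  obtain B C D where *: "Q = {B, C, D, A}" "distinct [B, C, D, A]"
    "lattice_config (symb B) (symb C) (symb D) (symb A)"
    using lattice_quadE[OF assms(1) A(1)] .
  have QA: "Q - {A} = {B, C, D}" using * by auto
  have "symb A + symb A' = 2 *\<^sub>R (symb B + symb C + symb D)"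
    using assms(2) * unfolding swap_def QA by (simp add: add.assoc)
  then have "symb A' = 2 *\<^sub>R (symb B + symb C + symb D) - symb A" by (simp add: algebra_simps)
  then have "lattice_config (symb B) (symb C) (symb D) (symb A')"
    using lattice_config_conjugate[OF *(3)] by simp
  moreover have "Q' = {B, C, D, A'}" using A QA by auto
  moreover have "distinct [B, C, D, A']" using * A by auto
  ultimately show ?thesis unfolding lattice_quad_def by blast
qed

lemma lattice_quad_swaps: "swaps\<^sup>*\<^sup>* Q Q' \<Longrightarrow> lattice_quad Q \<Longrightarrow> lattice_quad Q'"
  by (induction rule: rtranclp_induct) (auto simp: swaps_def intro: lattice_quad_swap)

lemma lattice_quad_integral:
  assumes "lattice_quad Q" "A \<in> Q"
  shows "integral_symbol (symb A)"
  using assms by (auto elim!: lattice_quadE simp: lattice_config_def)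

lemma lattice_quad_spinor:
  assumes "lattice_quad Q" "A \<in> Q" "B \<in> Q"
  shows "\<exists>z\<in>gaussian. spn (symb A) (symb B) = z\<^sup>2"
proof -
  obtain X Y Z where Q: "Q = {X, Y, Z, A}" and
    l: "spinorial (symb X) (symb Y) (symb Z) (symb A)"
    using lattice_quadE[OF assms(1,2)] by (metis lattice_config_def)
  \<comment> \<open>As -1 is the square of \<open>\<i>\<close>, the sign of a squared spinor is
    irrelevant to its being a Gaussian square.\<close>
  have neg: "\<exists>z\<in>gaussian. - (u\<^sup>2) = z\<^sup>2" if "u \<in> gaussian" for u
    using that by (intro bexI[of _ "\<i> * u"]) (auto simp: power_mult_distrib)
  obtain a b I where I: "a \<in> gaussian" "b \<in> gaussian" "I \<in> gaussian"
    and s: "spn (symb A) (symb X) = (b + (1 + I) * a)\<^sup>2" "spn (symb A) (symb Y) = - (b + I * a)\<^sup>2"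
    "spn (symb A) (symb Z) = - ((1 - I) * b + a)\<^sup>2"
    using l by (rule spinorialE) blast
  have "b + (1 + I) * a \<in> gaussian" "b + I * a \<in> gaussian" "(1 - I) * b + a \<in> gaussian"
    using I by auto
  then have "\<exists>z\<in>gaussian. spn (symb A) (symb X) = z\<^sup>2" "\<exists>z\<in>gaussian. spn (symb A) (symb Y) = z\<^sup>2"
    "\<exists>z\<in>gaussian. spn (symb A) (symb Z) = z\<^sup>2"
    unfolding s using neg by blast+
  moreover have "\<exists>z\<in>gaussian. spn (symb A) (symb A) = z\<^sup>2" by (rule bexI[of _ 0]) auto
  ultimately show ?thesis using assms(3) Q by blast
qed

lemma lattice_quad_packing:
  assumes l: "lattice_quad Q" and d: "descartes_config Q"
  shows "\<forall>A\<in>apollonian_packing Q. xdot A \<in> \<int> \<and> ydot A \<in> \<int> \<and> curv A \<in> \<int> \<and> cocurv A \<in> \<int>"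
    "\<forall>A\<in>apollonian_packing Q. \<forall>B\<in>apollonian_packing Q. tangent A B \<longrightarrow>
       (\<exists>m n :: int. spin_sq A B = (of_int m + \<i> * of_int n)\<^sup>2)"
    "\<forall>A\<in>apollonian_packing Q. (curv A - cocurv A) / 2 \<in> \<int> \<and> (curv A + cocurv A) / 2 \<in> \<int>"
proof -
  note t = tangent_quad_descartes[OF d]
  have "integral_symbol (symb A)" if "A \<in> apollonian_packing Q" for A
    using that descartes_steps_swaps[OF _ t] lattice_quad_swaps[OF _ l] lattice_quad_integral
    unfolding apollonian_packing_def by blast
  from integral_symbolD[OF this[unfolded symb_def]]
  show "\<forall>A\<in>apollonian_packing Q. xdot A \<in> \<int> \<and> ydot A \<in> \<int> \<and> curv A \<in> \<int> \<and> cocurv A \<in> \<int>"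
    "\<forall>A\<in>apollonian_packing Q. (curv A - cocurv A) / 2 \<in> \<int> \<and> (curv A + cocurv A) / 2 \<in> \<int>"
    by simp_all
  show "\<forall>A\<in>apollonian_packing Q. \<forall>B\<in>apollonian_packing Q. tangent A B \<longrightarrow>
       (\<exists>m n :: int. spin_sq A B = (of_int m + \<i> * of_int n)\<^sup>2)"
  proof (intro ballI impI)
    fix A B assume "A \<in> apollonian_packing Q" "B \<in> apollonian_packing Q" "tangent A B"
    then obtain Q' where "swaps\<^sup>*\<^sup>* Q Q'" "A \<in> Q'" "B \<in> Q'" using tangent_pair_common[OF t] by blast
    then obtain z where "z \<in> gaussian" "spn (symb A) (symb B) = z\<^sup>2"
      using lattice_quad_spinor lattice_quad_swaps[OF _ l] by blast
    then show "\<exists>m n :: int. spin_sq A B = (of_int m + \<i> * of_int n)\<^sup>2"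
      unfolding gaussian_iff spin_sq_symb by blast
  qed
qed

section \<open>From symbols back to disks, and the theorem\<close>

text \<open>The Lorentz product of two antiparallel half-planes is \<open>-1\<close> even if they overlap. A third disk
  of curvature \<open>a > 0\<close> rules this out: it forces the sum of their co-curvatures to be \<open>4 / a\<close>.\<close>
lemma tangent_quad_imp_descartes:
  assumes Q: "tangent_quad Q" and s: "\<forall>A\<in>Q. \<forall>B\<in>Q. A \<noteq> B \<longrightarrow> signs_ok A B"
    and pos: "\<exists>C\<in>Q. curv C > 0"
  shows "descartes_config Q"
proof -
  have "tangent A B" if AB: "A \<in> Q" "B \<in> Q" "A \<noteq> B" for A B
  proof (rule lip_imp_tangent)
    assume z: "curv A = 0" "curv B = 0"
    obtain C where C: "C \<in> Q" "curv C > 0" using pos by blast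
    then have "A \<noteq> C" "B \<noteq> C" using z by auto
    then have "lip (symb A + symb B) (symb C) = -2"
      using Q AB C by (simp add: tangent_quad_def)
    moreover have "fst (symb A + symb B) = 0"
    proof -
      obtain n h m k where "A = HalfPl n h" "B = HalfPl m k"
        using z Q AB by (cases A; cases B) (auto simp: tangent_quad_def)
      moreover have "lip (symb A) (symb B) = -1" using Q AB by (simp add: tangent_quad_def)
      moreover have "wf_disk A" "wf_disk B" using Q AB by (auto simp: tangent_quad_def)
      ultimately have "m = - n"
        using norm_unit_antipodal[of n m] by (simp add: lip_halfpl_halfpl)
      then show ?thesis using \<open>A = _\<close> \<open>B = _\<close> by (simp add: symb_simps)
    qed
    \<comment> \<open>Opposite normals cancel in the sum of the symbols, so only its co-curvature
      pairs with \<open>C\<close>, through the curvature of \<open>C\<close>.\<close>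
    ultimately have "(cocurv A + cocurv B) * curv C = 4"
      using z by (simp add: lip_def symb_def)
    then show "0 \<le> cocurv A + cocurv B" using C(2)
      by (metis zero_le_mult_iff zero_le_numeral not_less)
  qed (use AB Q s in \<open>auto simp: tangent_quad_def\<close>)
  then show ?thesis using Q unfolding descartes_config_def tangent_quad_def
    by (auto simp: tangent_def)
qed

theorem mainTheorem1:
  assumes "descartes_config Q"
    and "\<forall>A\<in>Q. curv A \<in> \<int>"
    and "Gcd ((\<lambda>A. \<lfloor>curv A\<rfloor>) ` Q) = 1"
  shows "\<exists>Q'. descartes_config Q' \<and>
           image_mset curv (mset_set Q') = image_mset curv (mset_set Q) \<and>
           (\<forall>A\<in>apollonian_packing Q'.
              xdot A \<in> \<int> \<and> ydot A \<in> \<int> \<and> curv A \<in> \<int> \<and> cocurv A \<in> \<int>) \<and>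
           (\<forall>A\<in>apollonian_packing Q'. \<forall>B\<in>apollonian_packing Q'. tangent A B \<longrightarrow>
              (\<exists>m n :: int. spin_sq A B = (of_int m + \<i> * of_int n)\<^sup>2)) \<and>
           (\<forall>A\<in>apollonian_packing Q'.
              (curv A - cocurv A) / 2 \<in> \<int> \<and> (curv A + cocurv A) / 2 \<in> \<int>)"
proof -
  note tq = tangent_quad_descartes[OF assms(1)]
  obtain A where "A \<in> Q" using tq by (fastforce simp: tangent_quad_def)
  obtain B C D where Q: "distinct [B, C, D, A]" "Q = {B, C, D, A}"
    "gram (symb B) (symb C) (symb D) (symb A)"
    using tangent_quadE[OF tq \<open>A \<in> Q\<close>] .
  define q where "q X = \<lfloor>curv X\<rfloor>" for X
  have q: "curv X = of_int (q X)" if "X \<in> Q" for X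
    using assms(2) that by (auto simp: q_def elim!: Ints_cases)
  have sg: "signs_ok X Y" if "X \<in> Q" "Y \<in> Q" "X \<noteq> Y" for X Y
    using assms(1) that tangent_imp_lip unfolding descartes_config_def by blast
  have gcd: "k dvd 1" if "k dvd q B" "k dvd q C" "k dvd q D" "k dvd q A" for k
  proof -
    have "k dvd Gcd ((\<lambda>A. \<lfloor>curv A\<rfloor>) ` Q)"
      by (rule Gcd_greatest) (use that Q in \<open>auto simp: q_def\<close>)
    then show ?thesis using assms(3) by simp
  qed
  \<comment> \<open>Otherwise 0 would divide all curvatures and hence 1.\<close>
  have "\<exists>X\<in>Q. q X \<noteq> 0" using gcd[of 0] Q by auto
  then obtain X where X: "X \<in> Q" "q X \<noteq> 0" by blast
  have sg': "q X + q Y > 0 \<or> q X = 0 \<and> q Y = 0" if "X \<in> Q" "Y \<in> Q" "X \<noteq> Y" for X Y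
    using sg[OF that] unfolding signs_ok_def by (simp add: q that flip: of_int_add)
  \<comment> \<open>Each pair has positive sum or consists of zeros. A pair containing the nonzero
    \<open>X\<close> has positive sum, and the complementary pair a nonnegative one.\<close>
  have sum: "q B + q C + q D + q A > 0"
    using X sg'[of B C] sg'[of B D] sg'[of B A] sg'[of C D] sg'[of C A] sg'[of D A] Q by auto
  have "2 * ((curv B)\<^sup>2 + (curv C)\<^sup>2 + (curv D)\<^sup>2 + (curv A)\<^sup>2) = (curv B + curv C + curv D + curv A)\<^sup>2"
    using Q(3) unfolding symb_def by (rule descartes_circle)
  then have "of_int (2 * ((q B)\<^sup>2 + (q C)\<^sup>2 + (q D)\<^sup>2 + (q A)\<^sup>2)) = (of_int ((q B + q C + q D + q A)\<^sup>2) :: real)"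
    using Q(2) by (simp add: q)
  then have "descartes_quad (q B) (q C) (q D) (q A)"
    unfolding descartes_quad_def of_int_eq_iff using sum gcd by blast
  then obtain v1 v2 v3 v4 where v: "lattice_config v1 v2 v3 v4"
    "fst (snd v1) = curv B" "fst (snd v2) = curv C" "fst (snd v3) = curv D" "fst (snd v4) = curv A"
    using realizable_descartes_quad[of "q B" "q C" "q D" "q A"] Q(2)
    unfolding realizable_def by (auto simp: q)
  have g: "gram v1 v2 v3 v4" using v(1) by (simp add: lattice_config_def)
  obtain B' C' D' A' where D': "wf_disk B'" "wf_disk C'" "wf_disk D'" "wf_disk A'"
    "symb B' = v1" "symb C' = v2" "symb D' = v3" "symb A' = v4"
    using ex_symb gram_all(1-4)[OF g] by metis
  have c: "curv B' = curv B" "curv C' = curv C" "curv D' = curv D" "curv A' = curv A"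
    using v(2-5) D'(5-8) by (auto simp: symb_def)
  define Q' where "Q' = {B', C', D', A'}"
  have dist: "distinct [B', C', D', A']"
    using gram_all[OF g] D'(5-8) by auto
  have tq': "tangent_quad Q'"
    using dist D' gram_all[OF g] unfolding tangent_quad_def Q'_def by auto
  have lq: "lattice_quad Q'"
    using v(1) D' dist unfolding lattice_quad_def Q'_def by blast
  have dc: "descartes_config Q'"
  \<comment> \<open>The sign conditions depend on the curvatures alone, so they carry over from
    \<open>Q\<close>.\<close>
  proof (rule tangent_quad_imp_descartes[OF tq'])
    have so: "signs_ok B C" "signs_ok B D" "signs_ok B A" "signs_ok C D" "signs_ok C A" "signs_ok D A"
      using sg Q by auto
    then show "\<forall>A\<in>Q'. \<forall>B\<in>Q'. A \<noteq> B \<longrightarrow> signs_ok A B"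
      unfolding Q'_def signs_ok_def using c by (auto simp: add.commute)
    have "curv B + curv C + curv D + curv A > 0"
      using sum Q(2) by (simp add: q flip: of_int_add)
    then have "curv B > 0 \<or> curv C > 0 \<or> curv D > 0 \<or> curv A > 0" by linarith
    then show "\<exists>C\<in>Q'. curv C > 0" unfolding Q'_def using c by auto
  qed
  have ms: "image_mset curv (mset_set Q') = image_mset curv (mset_set Q)"
    using dist Q(1) c unfolding Q'_def Q(2) by simp
  show ?thesis using dc ms lattice_quad_packing[OF lq dc] by blast
qed

end
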